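(* There is a constant $\alpha>0$ such that, with probability tending to $1$ as $n\to\infty$, when $A$, $B$, $\sigma_a$ and $\sigma_b$ are chosen independently and uniformly at random, every resolution refutation of $\mathsf{rAddPar}(a,b)$ contains at least $2^{\alpha n}$ clauses.
   Context: For literals $y_1,\dots,y_k$, $\mathsf{xor}(y_1,\dots,y_k)$ denotes the CNF consisting of all $2^{k-1}$ clauses on exactly the literals $y_1,\dots,y_k$ such that the number of unnegated $y_j$'s is odd when $k$ is odd and even when $k$ is even (it encodes $y_1\oplus\dots\oplus y_k=0$). For a list of $m\ge 4$ literals $(y_1,\dots,y_m)$ and fresh variables $t_1,\dots,t_{m-3}$, the linear encoding $\mathsf{Parity}$ of the list is $\mathsf{xor}(y_1,y_2,t_1)\wedge\bigwedge_{j=1}^{m-4}\mathsf{xor}(t_j,y_{j+2},t_{j+1})\wedge\mathsf{xor}(t_{m-3},y_{m-1},y_m)$. Let $X=\{x_1,\dots,x_n\}$. $A$ and $B$ are subsets of $X$ chosen uniformly at random (each of the $2^n$ subsets equally likely), $\sigma_a$ is a uniformly random ordering of $A$ and $\sigma_b$ a uniformly random ordering of $B$. Let $a=\mathsf{Parity}(A,S,\sigma_a)$ be the linear encoding of $A$ listed in order $\sigma_a$ with Tseitin variables $S$, and $b=\mathsf{Parity}(B,T,\sigma_b)$ likewise with Tseitin variables $T$. Let $C$ be the symmetric difference $A\triangle B$ with one of its literals negated, listed in increasing order of variable index, and $U$ fresh Tseitin variables. Then $\mathsf{rAddPar}(a,b)=a\wedge b\wedge\mathsf{Parity}(C,U,\mathrm{id})$,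 where $S,T,U,X$ are pairwise disjoint; it is unsatisfiable. Resolution derives $C_1\vee C_2$ from $C_1\vee x$ and $C_2\vee\bar x$; a refutation derives the empty clause, and its length is its number of clauses. *)

theory Defs
  imports "HOL-Probability.Probability" "HOL-Combinatorics.Multiset_Permutations"
begin

datatype 'v literal = Pos 'v | Neg 'v

fun neg :: "'v literal \<Rightarrow> 'v literal" where
  "neg (Pos x) = Neg x"
| "neg (Neg x) = Pos x"

type_synonym 'v clause = "'v literal set"
type_synonym 'v cnf = "'v clause set"

fun lit_true :: "('v \<Rightarrow> bool) \<Rightarrow> 'v literal \<Rightarrow> bool" where
  "lit_true v (Pos x) \<longleftrightarrow> v x"
| "lit_true v (Neg x) \<longleftrightarrow> \<not> v x"

definition satisfies :: "('v \<Rightarrow> bool) \<Rightarrow> 'v cnf \<Rightarrow> bool" where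
  "satisfies v F \<longleftrightarrow> (\<forall>c\<in>F. \<exists>l\<in>c. lit_true v l)"

definition signed_clause :: "'v literal list \<Rightarrow> nat set \<Rightarrow> 'v clause" where
  "signed_clause ys N =
     (\<lambda>i. if i \<in> N then neg (ys ! i) else ys ! i) ` {..<length ys}"

text \<open>
  The clause \<open>signed_clause ys N\<close> excludes exactly the assignments under which the true literals
  of \<open>ys\<close> are those at the positions in \<open>N\<close>. Hence an odd number of negations encodes that the
  exclusive or of \<open>ys\<close> is 0 (lemma \<open>satisfies_xor_cnf\<close>). In terms of the unnegated literals, their
  number is even if the length of \<open>ys\<close> is odd, and odd if the length is even. The opposite
  convention encodes that the exclusive or is 1; for lists of odd length it differs from this one
  only by negating every literal (lemma \<open>neg_image_xor_cnf\<close>).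
\<close>

definition xor_cnf :: "'v literal list \<Rightarrow> 'v cnf" where
  "xor_cnf ys = {signed_clause ys N | N. N \<subseteq> {..<length ys} \<and> odd (card N)}"

lemma neg_neg [simp]: "neg (neg l) = l"
  by (cases l) auto

lemma lit_true_neg [simp]: "lit_true v (neg l) \<longleftrightarrow> \<not> lit_true v l"
  by (cases l) auto

lemma satisfies_xor_cnf:
  "satisfies v (xor_cnf ys) \<longleftrightarrow> even (card {i. i < length ys \<and> lit_true v (ys ! i)})"
proof -
  let ?M = "{i. i < length ys \<and> lit_true v (ys ! i)}"
  have M: "?M \<subseteq> {..<length ys}"
    by auto
  have falsified: "(\<forall>l\<in>signed_clause ys N. \<not> lit_true v l) \<longleftrightarrow> N = ?M"
    if N: "N \<subseteq> {..<length ys}" for N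
  proof -
    have "\<not> lit_true v (if i \<in> N then neg (ys ! i) else ys ! i) \<longleftrightarrow> (lit_true v (ys ! i) \<longleftrightarrow> i \<in> N)"
      for i by simp
    then have "(\<forall>l\<in>signed_clause ys N. \<not> lit_true v l)
        \<longleftrightarrow> (\<forall>i\<in>{..<length ys}. lit_true v (ys ! i) \<longleftrightarrow> i \<in> N)"
      unfolding signed_clause_def Set.ball_simps(9) by (simp only: )
    also have "\<dots> \<longleftrightarrow> N = ?M"
      unfolding set_eq_iff mem_Collect_eq Ball_def lessThan_iff using N by blast
    finally show ?thesis .
  qed
  show ?thesis
  proof
    assume sat: "satisfies v (xor_cnf ys)"
    show "even (card ?M)"
    proof (rule ccontr)
      assume "odd (card ?M)"
      then have "signed_clause ys ?M \<in> xor_cnf ys"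
        unfolding xor_cnf_def using M by (intro CollectI exI[of _ ?M]) simp
      with sat falsified[OF M] show False
        unfolding satisfies_def by metis
    qed
  next
    assume even: "even (card ?M)"
    show "satisfies v (xor_cnf ys)"
      unfolding satisfies_def
    proof
      fix c assume "c \<in> xor_cnf ys"
      then obtain N where N: "N \<subseteq> {..<length ys}" "odd (card N)" "c = signed_clause ys N"
        unfolding xor_cnf_def by (elim CollectE exE conjE)
      with even have "N \<noteq> ?M"
        by metis
      with falsified[OF N(1)] N(3) show "\<exists>l\<in>c. lit_true v l"
        by metis
    qed
  qed
qed

lemma neg_image_xor_cnf:
  assumes "odd (length ys)"
  shows "(`) neg ` xor_cnf ys = {signed_clause ys N | N. N \<subseteq> {..<length ys} \<and> even (card N)}"
proof -
  have img: "neg ` signed_clause ys N = signed_clause ys ({..<length ys} - N)" for N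
    unfolding signed_clause_def image_image by (rule image_cong) simp_all
  have par: "even (card ({..<length ys} - N)) \<longleftrightarrow> odd (card N)"
    if N: "N \<subseteq> {..<length ys}" for N
  proof -
    have "card ({..<length ys} - N) + card N = length ys"
      using card_Diff_subset[OF finite_subset[OF N] N] card_mono[OF _ N] by simp
    with assms have "odd (card ({..<length ys} - N) + card N)"
      by metis
    then show ?thesis
      by (metis even_add)
  qed
  have compl: "{..<length ys} - ({..<length ys} - N) = N" if "N \<subseteq> {..<length ys}" for N
    using that by (rule double_diff) simp
  show ?thesis
  proof (intro equalityI subsetI)
    fix c assume "c \<in> (`) neg ` xor_cnf ys"
    then obtain N where N: "N \<subseteq> {..<length ys}" "odd (card N)" "c = neg ` signed_clause ys N"
      unfolding xor_cnf_def by (elim imageE CollectE exE conjE) simp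
    then show "c \<in> {signed_clause ys N | N. N \<subseteq> {..<length ys} \<and> even (card N)}"
      using par[OF N(1)] img[of N] by (intro CollectI exI[of _ "{..<length ys} - N"]) simp
  next
    fix c assume "c \<in> {signed_clause ys N | N. N \<subseteq> {..<length ys} \<and> even (card N)}"
    then obtain N where N: "N \<subseteq> {..<length ys}" "even (card N)" "c = signed_clause ys N"
      by (elim CollectE exE conjE)
    let ?N = "{..<length ys} - N"
    have "signed_clause ys ?N \<in> xor_cnf ys"
      unfolding xor_cnf_def using par[OF N(1)] N(2) by (intro CollectI exI[of _ ?N]) simp
    moreover have "c = neg ` signed_clause ys ?N"
      using N(3) img[of ?N] compl[OF N(1)] by simp
    ultimately show "c \<in> (`) neg ` xor_cnf ys"
      by (rule rev_image_eqI)
  qed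
qed

text \<open>
  The auxiliary variables are \<open>t 1, \<dots>, t (m - 3)\<close>. The list \<open>ys\<close> is indexed from 0. Lists of
  fewer than 4 literals need no auxiliary variables and are encoded directly.
\<close>

definition parity_cnf :: "(nat \<Rightarrow> 'v) \<Rightarrow> 'v literal list \<Rightarrow> 'v cnf" where
  "parity_cnf t ys = (let m = length ys in
     if m < 4 then xor_cnf ys
     else xor_cnf [ys ! 0, ys ! 1, Pos (t 1)]
        \<union> (\<Union>j\<in>{1..m - 4}. xor_cnf [Pos (t j), ys ! (j + 1), Pos (t (j + 1))])
        \<union> xor_cnf [Pos (t (m - 3)), ys ! (m - 2), ys ! (m - 1)])"

datatype var = XVar nat | SVar nat | TVar nat | UVar nat

text \<open>
  The lists \<open>as\<close> and \<open>bs\<close> are orderings of the index sets of \<open>A\<close> and \<open>B\<close>; the index \<open>z\<close> of the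
  literal that is negated in the third constraint ranges over the symmetric difference.
\<close>

definition rAddPar :: "nat list \<Rightarrow> nat list \<Rightarrow> nat \<Rightarrow> var cnf" where
  "rAddPar as bs z =
     parity_cnf SVar (map (\<lambda>i. Pos (XVar i)) as)
     \<union> parity_cnf TVar (map (\<lambda>i. Pos (XVar i)) bs)
     \<union> parity_cnf UVar (map (\<lambda>i. if i = z then Neg (XVar i) else Pos (XVar i))
         (sorted_list_of_set (sym_diff (set as) (set bs))))"

definition resolvent :: "'v clause \<Rightarrow> 'v clause \<Rightarrow> 'v clause \<Rightarrow> bool" where
  "resolvent D1 D2 D \<longleftrightarrow>
     (\<exists>x. Pos x \<in> D1 \<and> Neg x \<in> D2 \<and> D = (D1 - {Pos x}) \<union> (D2 - {Neg x}))"

definition resolution_refutation :: "'v cnf \<Rightarrow> 'v clause list \<Rightarrow> bool" where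
  "resolution_refutation F \<pi> \<longleftrightarrow>
     {} \<in> set \<pi> \<and>
     (\<forall>i<length \<pi>. \<pi> ! i \<in> F \<or> (\<exists>j<i. \<exists>k<i. resolvent (\<pi> ! j) (\<pi> ! k) (\<pi> ! i)))"

definition random_instance :: "nat \<Rightarrow> (nat set \<times> nat set \<times> nat list \<times> nat list) pmf" where
  "random_instance n = do {
     A \<leftarrow> pmf_of_set (Pow {1..n});
     B \<leftarrow> pmf_of_set (Pow {1..n});
     as \<leftarrow> pmf_of_set (permutations_of_set A);
     bs \<leftarrow> pmf_of_set (permutations_of_set B);
     return_pmf (A, B, as, bs)
   }"

end

theory Submission
  imports Defs "HOL-Real_Asymp.Real_Asymp"
begin

text \<open>
  By the method of Ben-Sasson and Wigderson, a refutation of length \<open>2\<^sup>o\<^sup>(\<^sup>n\<^sup>)\<close> would give one of width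
  \<open>o(n)\<close>, since there are only \<open>O(n)\<close> variables. The formula is a Tseitin formula on three paths
  (the chains of \<open>A\<close>, \<open>B\<close> and \<open>A \<triangle> B\<close>), in which every \<open>x \<in> D = A \<inter> B\<close> is an edge between the first
  two paths. If every set of constraints that hosts, on the first path, between a third and two
  thirds of \<open>D\<close> has a boundary of linear size, then the width is linear. A set of small boundary
  meets both paths in few intervals, and it hosts almost the same elements of \<open>D\<close> on both. There
  are only \<open>2\<^sup>\<epsilon>\<^sup>n\<close> candidates for its two traces, and a random order of \<open>B\<close> turns a fixed trace on the
  second path into a given \<open>j\<close>-subset of \<open>D\<close> with probability at most one over \<open>|D|\<close> choose \<open>j\<close>,
  so a union bound applies. Finally \<open>|D|\<close> is at least \<open>n / 8\<close> with high probability.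
\<close>

section \<open>Literals and their variables\<close>

primrec var_of :: "'v literal \<Rightarrow> 'v" where
  "var_of (Pos x) = x"
| "var_of (Neg x) = x"

lemma var_of_neg [simp]: "var_of (neg l) = var_of l"
  by (cases l) auto

lemma neg_neq [simp]: "neg l \<noteq> l" "l \<noteq> neg l"
  by (cases l; simp)+

lemma var_of_eq_iff: "var_of l = var_of l' \<longleftrightarrow> l = l' \<or> l = neg l'"
  by (cases l; cases l') auto

section \<open>Size versus width\<close>

text \<open>Both rules include weakening, so that derivations are closed under assigning a literal.\<close>

inductive der :: "'v cnf \<Rightarrow> 'v clause set \<Rightarrow> 'v clause \<Rightarrow> bool" for F P where
  ax: "D \<in> F \<Longrightarrow> D \<subseteq> C \<Longrightarrow> C \<in> P \<Longrightarrow> der F P C"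
| res: "der F P C1 \<Longrightarrow> der F P C2 \<Longrightarrow> C1 - {l} \<subseteq> C \<Longrightarrow> C2 - {neg l} \<subseteq> C \<Longrightarrow> C \<in> P \<Longrightarrow> der F P C"

lemma der_in: "der F P C \<Longrightarrow> C \<in> P"
  by (induction rule: der.induct)

lemma der_weaken: "der F P C \<Longrightarrow> C \<subseteq> C' \<Longrightarrow> C' \<in> P \<Longrightarrow> der F P C'"
  by (rule der.res[of F P C C]) auto

lemma der_mono: "der F P C \<Longrightarrow> (\<And>D. der F P D \<Longrightarrow> D \<in> P') \<Longrightarrow> der F P' C"
  by (induction rule: der.induct) (blast intro: der.intros)+

text \<open>\<open>card\<close> of an infinite set is 0, so without \<open>finite\<close> an
  infinite clause would count as narrow.\<close>

definition clauses_le :: "nat \<Rightarrow> 'v clause set" where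
  "clauses_le w = {C. finite C \<and> card C \<le> w}"

text \<open>The usual restriction of a CNF under the partial assignment that makes \<open>l\<close>
  true.\<close>

definition assign :: "'v literal \<Rightarrow> 'v clause set \<Rightarrow> 'v clause set" where
  "assign l F = (\<lambda>C. C - {neg l}) ` {C \<in> F. l \<notin> C}"

text \<open>A step that resolves on \<open>l\<close> or \<open>neg l\<close> has a premise without
  \<open>l\<close>, whose restriction already lies inside the restricted conclusion. Any other step
  remains a step after the restriction.\<close>

lemma der_assign:
  assumes "der F P C" "l \<notin> C"
  shows "der (assign l F) (assign l P) (C - {neg l})"
  using assms
proof (induction rule: der.induct)
  case (ax D C)
  then show ?case
    by (intro der.ax[of "D - {neg l}"]) (auto simp: assign_def)
next
  case (res C1 C2 l' C)
  have C: "C - {neg l} \<in> assign l P"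
    using res by (auto simp: assign_def)
  consider "l = l'" | "l = neg l'" | "l \<noteq> l'" "l \<noteq> neg l'" by blast
  then show ?case
  proof cases
    case 1
    then have "l \<notin> C2" using res.hyps res.prems by auto
    from res.IH(2)[OF this] show ?thesis
      by (rule der_weaken) (use 1 res.hyps C in auto)
  next
    case 2
    then have "l \<notin> C1" using res.hyps res.prems by auto
    from res.IH(1)[OF this] show ?thesis
      by (rule der_weaken) (use 2 res.hyps C in auto)
  next
    case 3
    then have "l \<notin> C1" "l \<notin> C2" using res.hyps res.prems by auto
    with res.IH have "der (assign l F) (assign l P) (C1 - {neg l})"
      "der (assign l F) (assign l P) (C2 - {neg l})" by auto
    then show ?thesis
      by (rule der.res[where l = l']) (use res.hyps C in auto)
  qed
qed

text \<open>Adding \<open>neg l\<close> to every line turns the restricted axioms into weakenings of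
  axioms of \<open>F\<close>, at the price of one unit of width.\<close>

lemma der_unassign:
  assumes "der (assign l F) (clauses_le w) C"
  shows "der F (clauses_le (Suc w)) (insert (neg l) C)"
  using assms
proof (induction rule: der.induct)
  case (ax D C)
  then obtain E where "E \<in> F" "D = E - {neg l}" by (auto simp: assign_def)
  with ax show ?case
    by (intro der.ax[of E]) (auto simp: clauses_le_def card_insert_if)
next
  case (res C1 C2 l' C)
  show ?case
    by (rule der.res[OF res.IH, of l'])
       (use res.hyps in \<open>auto simp: clauses_le_def card_insert_if\<close>)
qed

text \<open>With the unit clause at hand, \<open>l\<close> is first resolved away from each axiom;
  the restricted derivation then runs in unchanged width.\<close>

lemma der_resolve_assign:
  assumes "der (assign (neg l) F) (clauses_le w) C"
    and unit: "der F (clauses_le w) {neg l}" and F: "F \<subseteq> clauses_le w"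
  shows "der F (clauses_le w) C"
  using assms(1)
proof (induction rule: der.induct)
  case (ax D C)
  then obtain E where E: "E \<in> F" "D = E - {l}" by (auto simp: assign_def)
  then have "der F (clauses_le w) E" using F by (auto intro: der.ax)
  then show ?case by (rule der.res[OF _ unit, of _ l]) (use ax E in auto)
qed (blast intro: der.res)

lemma assign_clauses_le: "F \<subseteq> clauses_le w \<Longrightarrow> assign l F \<subseteq> clauses_le w"
  unfolding assign_def clauses_le_def
  by (auto intro: order_trans[OF card_mono])

section \<open>Fat clauses and their most frequent literal\<close>

definition lits :: "'v set \<Rightarrow> 'v literal set" where
  "lits V = Pos ` V \<union> Neg ` V"

lemma mem_lits [simp]: "l \<in> lits V \<longleftrightarrow> var_of l \<in> V"
  by (cases l) (auto simp: lits_def)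

lemma finite_lits: "finite V \<Longrightarrow> finite (lits V)"
  by (simp add: lits_def)

lemma card_lits_le: "card (lits V) \<le> 2 * card V"
proof -
  have "card (lits V) \<le> card (Pos ` V) + card (Neg ` V)"
    unfolding lits_def by (rule card_Un_le)
  also have "\<dots> = 2 * card V" by (simp add: card_image inj_on_def)
  finally show ?thesis .
qed

text \<open>Averaging: counted with multiplicity, the clauses contain at least
  \<open>d * card P\<close> literals, and at most \<open>2 * card V\<close> different literals are
  available.\<close>

lemma popular_literal:
  fixes P :: "'v clause set"
  assumes V: "finite V" and P: "P \<subseteq> Pow (lits V)" and fat: "\<forall>C\<in>P. d < card C" and "P \<noteq> {}"
  obtains l where "l \<in> lits V" "d * card P \<le> 2 * card V * card {C \<in> P. l \<in> C}"
proof -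
  have fin: "finite P" using P V finite_subset[OF P] by (simp add: finite_lits)
  have False if "\<forall>l\<in>lits V. 2 * card V * card {C \<in> P. l \<in> C} < d * card P"
  proof -
    have ne: "lits V \<noteq> {}" using P fat \<open>P \<noteq> {}\<close> by (metis PowD card.empty ex_in_conv not_less_zero subsetD subset_empty)
    then have "0 < card V" using V by (auto simp: lits_def card_gt_0_iff)
    have "d * card P \<le> (\<Sum>C\<in>P. card C)"
      using sum_mono[of P "\<lambda>_. d" card] fat by (simp add: mult.commute less_imp_le)
    also have "\<dots> = (\<Sum>C\<in>P. \<Sum>l\<in>lits V. if l \<in> C then 1 else 0)"
    proof (rule sum.cong[OF refl])
      fix C assume "C \<in> P"
      then have "lits V \<inter> {l. l \<in> C} = C" using P by blast
      then show "card C = (\<Sum>l\<in>lits V. if l \<in> C then 1 else 0)"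
        using V by (simp add: finite_lits sum.If_cases)
    qed
    also have "\<dots> = (\<Sum>l\<in>lits V. \<Sum>C\<in>P. if l \<in> C then 1 else 0)"
      by (rule sum.swap)
    also have "\<dots> = (\<Sum>l\<in>lits V. card {C \<in> P. l \<in> C})"
      using fin by (simp add: sum.If_cases Int_def)
    finally have "2 * card V * (d * card P) \<le> (\<Sum>l\<in>lits V. 2 * card V * card {C \<in> P. l \<in> C})"
      by (simp add: sum_distrib_left[symmetric])
    also have "\<dots> < (\<Sum>l\<in>lits V. d * card P)"
      by (rule sum_strict_mono) (use V that ne in \<open>auto simp: finite_lits\<close>)
    also have "\<dots> \<le> 2 * card V * (d * card P)"
      using card_lits_le[of V] by (simp add: mult_le_mono)
    finally show False by simp
  qed
  then show ?thesis using that by (meson not_le)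
qed

lemma card_fat_assign:
  assumes "finite P"
  shows "card {C \<in> assign l P. d < card C} \<le> card {C \<in> P. d < card C \<and> l \<notin> C}"
proof -
  have "{C \<in> assign l P. d < card C} \<subseteq> (\<lambda>C. C - {neg l}) ` {C \<in> P. d < card C \<and> l \<notin> C}"
  proof
    fix D assume "D \<in> {C \<in> assign l P. d < card C}"
    then obtain C where C: "C \<in> P" "l \<notin> C" "D = C - {neg l}" "d < card D"
      by (auto simp: assign_def)
    then have "finite D" using card.infinite by fastforce
    then have "finite C" using C(3) by simp
    then have "card D \<le> card C" using C by (auto intro: card_mono)
    then show "D \<in> (\<lambda>C. C - {neg l}) ` {C \<in> P. d < card C \<and> l \<notin> C}" using C by auto
  qed
  then show ?thesis
    by (rule surj_card_le[rotated]) (use assms in simp)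
qed

lemma assign_lits:
  assumes "P \<subseteq> Pow (lits V)"
  shows "assign l P \<subseteq> Pow (lits (V - {var_of l}))"
proof
  fix D assume "D \<in> assign l P"
  then obtain C where C: "C \<in> P" "l \<notin> C" "D = C - {neg l}" by (auto simp: assign_def)
  have "var_of l' \<in> V - {var_of l}" if "l' \<in> D" for l'
  proof -
    have "l' \<in> lits V" using that C assms by blast
    moreover have "l' \<noteq> l" "l' \<noteq> neg l" using that C by auto
    ultimately show ?thesis using var_of_eq_iff[of l' l] by simp
  qed
  then show "D \<in> Pow (lits (V - {var_of l}))" by auto
qed

text \<open>Clauses of more than \<open>d\<close> literals are fat. By induction on the number of
  variables, a popular literal is set to true, which removes a share of at least
  \<open>d / (2 * N)\<close> of the fat clauses and lowers \<open>b\<close> by one, and to false.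
  \<open>N\<close> stays fixed while \<open>V\<close> shrinks, so the share is the same at every
  level.\<close>

theorem size_width:
  fixes F P :: "'v clause set"
  assumes "finite V" "card V \<le> N" "P \<subseteq> Pow (lits V)" "der F P {}" "F \<subseteq> clauses_le w"
    and "d \<le> N" and "real (card {C \<in> P. d < card C}) * (1 - real d / (2 * real N)) ^ b < 1"
  shows "der F (clauses_le (w + d + b)) {}"
  using assms
proof (induction "card V" arbitrary: V F P b rule: less_induct)
  case less
  let ?fat = "\<lambda>P. {C \<in> P. d < card C}"
  let ?q = "1 - real d / (2 * real N)"
  have q: "0 \<le> ?q" using \<open>d \<le> N\<close> by (cases "N = 0") (auto simp: field_simps)
  have finlits: "finite (lits V)" by (rule finite_lits) fact
  have finP: "finite P"
    by (rule finite_subset[OF less.prems(3)]) (use finlits in simp)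
  show ?case
  proof (cases "?fat P = {}")
    case True
    show ?thesis
    proof (rule der_mono[OF \<open>der F P {}\<close>])
      fix D assume "der F P D"
      then have D: "D \<in> P" by (rule der_in)
      with less.prems have "D \<subseteq> lits V" by auto
      then have "finite D" using finlits finite_subset by auto
      moreover have "card D \<le> d" using D True by (auto simp: not_less)
      ultimately show "D \<in> clauses_le (w + d + b)" by (simp add: clauses_le_def)
    qed
  next
    case False
    obtain l where l: "l \<in> lits V" and
      pop: "d * card (?fat P) \<le> 2 * card V * card {C \<in> ?fat P. l \<in> C}"
      using popular_literal[of V "?fat P" d] less.prems False by blast
    have x: "var_of l \<in> V" using l by simp
    define V' where "V' = V - {var_of l}"
    have V': "finite V'" "card V' < card V" "card V' \<le> N"
      using less.prems(1,2) card_Diff1_less[OF less.prems(1) x] by (simp_all add: V'_def)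
    have "real N > 0" using V'(2) less.prems(2) by simp
    \<comment> \<open>For \<open>b = 0\<close> the last hypothesis says that fewer than one clause
      is fat, which this case excludes.\<close>
    obtain b' where b': "b = Suc b'"
    proof (cases b)
      case 0
      have "card (?fat P) \<ge> 1" using False finP by (simp add: Suc_le_eq card_gt_0_iff)
      with 0 less.prems have False by simp
      then show ?thesis ..
    qed
    have "card (?fat (assign l P)) \<le> card {C \<in> P. d < card C \<and> l \<notin> C}"
      by (rule card_fat_assign[OF finP])
    also have "{C \<in> P. d < card C \<and> l \<notin> C} = ?fat P - {C \<in> ?fat P. l \<in> C}" by auto
    also have "card \<dots> = card (?fat P) - card {C \<in> ?fat P. l \<in> C}"
      by (rule card_Diff_subset) (use finP in auto)
    finally have "card (?fat (assign l P)) \<le> card (?fat P) - card {C \<in> ?fat P. l \<in> C}" .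
    moreover have "card {C \<in> ?fat P. l \<in> C} \<le> card (?fat P)"
      using finP by (intro card_mono) auto
    ultimately have fewer: "real (card (?fat (assign l P))) \<le>
        real (card (?fat P)) - real (card {C \<in> ?fat P. l \<in> C})" by linarith
    have "real d * card (?fat P) \<le> 2 * real (card V) * card {C \<in> ?fat P. l \<in> C}"
      using of_nat_mono[OF pop, where 'a = real] by simp
    also have "\<dots> \<le> 2 * real N * card {C \<in> ?fat P. l \<in> C}"
      using less.prems by (intro mult_right_mono) auto
    finally have "real d / (2 * real N) * card (?fat P) \<le> card {C \<in> ?fat P. l \<in> C}"
      using \<open>real N > 0\<close> by (simp add: field_simps)
    with fewer have "real (card (?fat (assign l P))) \<le> ?q * card (?fat P)"
      by (simp add: algebra_simps)
    then have "real (card (?fat (assign l P))) * ?q ^ b' \<le> ?q * card (?fat P) * ?q ^ b'"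
      using q by (intro mult_right_mono) auto
    also have "\<dots> < 1" using less.prems(7) b' by (simp add: algebra_simps)
    finally have fat1: "real (card (?fat (assign l P))) * ?q ^ b' < 1" .
    have "card (?fat (assign (neg l) P)) \<le> card (?fat P)"
      by (rule order_trans[OF card_fat_assign[OF finP]], rule card_mono) (use finP in auto)
    then have "real (card (?fat (assign (neg l) P))) * ?q ^ b \<le> real (card (?fat P)) * ?q ^ b"
      using q by (intro mult_right_mono) auto
    with less.prems have fat2: "real (card (?fat (assign (neg l) P))) * ?q ^ b < 1" by linarith
    have "der (assign l F) (clauses_le (w + d + b')) {}"
      using less.hyps[OF V'(2) V'(1) V'(3) _ _ assign_clauses_le \<open>d \<le> N\<close> fat1]
        assign_lits[of P V l] der_assign[of F P "{}" l] less.prems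
      by (simp add: V'_def)
    \<comment> \<open>The branch with \<open>l\<close> true has one unit less in \<open>b\<close>,
      which pays for putting \<open>neg l\<close> back.\<close>
    from der_unassign[OF this] have unit: "der F (clauses_le (w + d + b)) {neg l}"
      by (simp add: b')
    \<comment> \<open>The branch with \<open>l\<close> false keeps \<open>b\<close>: once
      \<open>{neg l}\<close> is derived, returning to \<open>F\<close> costs no width.\<close>
    have "der (assign (neg l) F) (clauses_le (w + d + b)) {}"
      using less.hyps[OF V'(2) V'(1) V'(3) _ _ assign_clauses_le \<open>d \<le> N\<close> fat2]
        assign_lits[of P V "neg l"] der_assign[of F P "{}" "neg l"] less.prems
      by (simp add: V'_def)
    then show ?thesis
      by (rule der_resolve_assign[OF _ unit])
        (use less.prems(5) in \<open>auto simp: clauses_le_def\<close>)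
  qed
qed

text \<open>Resolvents contain no new literals, so every line of \<open>\<pi>\<close> passes the
  filter, which brings the clauses into the form that \<open>size_width\<close> expects.\<close>

lemma refutation_der:
  assumes "resolution_refutation F \<pi>" and F: "F \<subseteq> Pow (lits V)"
  shows "der F {C \<in> set \<pi>. C \<subseteq> lits V} {}"
proof -
  have "der F {C \<in> set \<pi>. C \<subseteq> lits V} (\<pi> ! i)" if "i < length \<pi>" for i
    using that
  proof (induction i rule: less_induct)
    case (less i)
    then have "\<pi> ! i \<in> F \<or> (\<exists>j<i. \<exists>k<i. resolvent (\<pi> ! j) (\<pi> ! k) (\<pi> ! i))"
      using assms unfolding resolution_refutation_def by blast
    then show ?case
    proof
      assume "\<pi> ! i \<in> F"
      then show ?thesis using F less.prems by (intro der.ax[of "\<pi> ! i"]) auto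
    next
      assume "\<exists>j<i. \<exists>k<i. resolvent (\<pi> ! j) (\<pi> ! k) (\<pi> ! i)"
      then obtain j k x where jk: "j < i" "k < i"
        and D: "\<pi> ! i = \<pi> ! j - {Pos x} \<union> (\<pi> ! k - {Neg x})"
        unfolding resolvent_def by blast
      have 1: "der F {C \<in> set \<pi>. C \<subseteq> lits V} (\<pi> ! j)" "der F {C \<in> set \<pi>. C \<subseteq> lits V} (\<pi> ! k)"
        using less jk by auto
      show ?thesis
      proof (rule der.res[OF 1])
        show "\<pi> ! j - {Pos x} \<subseteq> \<pi> ! i" "\<pi> ! k - {neg (Pos x)} \<subseteq> \<pi> ! i"
          using D by auto
        have "\<pi> ! i \<subseteq> lits V" using D 1[THEN der_in] by blast
        then show "\<pi> ! i \<in> {C \<in> set \<pi>. C \<subseteq> lits V}" using less.prems by simp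
      qed
    qed
  qed
  then show ?thesis
    using assms(1) unfolding resolution_refutation_def by (metis in_set_conv_nth)
qed

section \<open>Width lower bounds for systems of parity constraints\<close>

lemma satisfies_xor_cnf_flip:
  assumes "distinct (map var_of ys)" "x \<in> var_of ` set ys"
  shows "satisfies (v(x := \<not> v x)) (xor_cnf ys) \<longleftrightarrow> \<not> satisfies v (xor_cnf ys)"
proof -
  obtain i where i: "i < length ys" "var_of (ys ! i) = x"
    using assms(2) by (auto simp: in_set_conv_nth)
  let ?v = "v(x := \<not> v x)"
  define M where "M = {j. j < length ys \<and> lit_true v (ys ! j)}"
  define M' where "M' = {j. j < length ys \<and> lit_true ?v (ys ! j)}"
  \<comment> \<open>As the variables are pairwise distinct, flipping \<open>x\<close> affects the
    literal at \<open>i\<close> alone, so \<open>M\<close> and \<open>M'\<close> differ exactly in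
    \<open>i\<close>.\<close>
  have other: "lit_true ?v (ys ! j) \<longleftrightarrow> lit_true v (ys ! j)" if "j < length ys" "j \<noteq> i" for j
  proof -
    have "var_of (ys ! j) \<noteq> x"
      using that i assms(1) by (metis distinct_conv_nth length_map nth_map)
    then show ?thesis by (cases "ys ! j") auto
  qed
  have this_one: "lit_true ?v (ys ! i) \<longleftrightarrow> \<not> lit_true v (ys ! i)"
    using i by (cases "ys ! i") auto
  have fin: "finite M" "finite M'" by (auto simp: M_def M'_def)
  have "even (card M') \<longleftrightarrow> odd (card M)"
  proof (cases "i \<in> M")
    case True
    then have "M = insert i M'" "i \<notin> M'" using other this_one i by (auto simp: M_def M'_def)
    then show ?thesis using fin by simp
  next
    case False
    then have "M' = insert i M" using other this_one i by (auto simp: M_def M'_def)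
    then show ?thesis using fin False by simp
  qed
  then show ?thesis by (simp add: satisfies_xor_cnf M_def M'_def)
qed

lemma satisfies_xor_cnf_fresh:
  assumes "x \<notin> var_of ` set ys"
  shows "satisfies (v(x := b)) (xor_cnf ys) \<longleftrightarrow> satisfies v (xor_cnf ys)"
proof -
  have "lit_true (v(x := b)) (ys ! j) \<longleftrightarrow> lit_true v (ys ! j)" if "j < length ys" for j
    using assms nth_mem[OF that] by (cases "ys ! j") (force simp: image_iff)+
  then show ?thesis unfolding satisfies_xor_cnf by (metis (mono_tags, lifting) Collect_cong)
qed

text \<open>The unique neighbours of \<open>S\<close>. If every variable occurs in two constraints,
  these are the edges of the constraint graph with exactly one end in \<open>S\<close>.\<close>

definition boundary :: "('i \<Rightarrow> 'v literal list) \<Rightarrow> 'i set \<Rightarrow> 'v set" where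
  "boundary L S = {x. \<exists>!i. i \<in> S \<and> x \<in> var_of ` set (L i)}"

definition implies :: "('i \<Rightarrow> 'v literal list) \<Rightarrow> 'i set \<Rightarrow> 'v clause \<Rightarrow> bool" where
  "implies L S C \<longleftrightarrow>
     (\<forall>v. (\<forall>i\<in>S. satisfies v (xor_cnf (L i))) \<longrightarrow> (\<exists>l\<in>C. lit_true v l))"

text \<open>By minimality some assignment falsifies \<open>C\<close> and satisfies all constraints
  but \<open>i\<close>, the only one with the boundary variable \<open>x\<close>. Flipping
  \<open>x\<close> repairs \<open>i\<close> and touches no other constraint, so \<open>C\<close>
  becomes true, which only a literal on \<open>x\<close> can cause.\<close>

lemma boundary_subset_vars:
  assumes imp: "implies L S C" and minimal: "\<forall>i\<in>S. \<not> implies L (S - {i}) C"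
    and dist: "\<And>i. i \<in> S \<Longrightarrow> distinct (map var_of (L i))"
  shows "boundary L S \<subseteq> var_of ` C"
proof
  fix x assume "x \<in> boundary L S"
  then obtain i where i: "i \<in> S" "x \<in> var_of ` set (L i)"
    and uniq: "\<And>j. j \<in> S \<Longrightarrow> x \<in> var_of ` set (L j) \<Longrightarrow> j = i"
    unfolding boundary_def by blast
  from minimal i(1) obtain v where v: "\<forall>j\<in>S - {i}. satisfies v (xor_cnf (L j))"
    "\<forall>l\<in>C. \<not> lit_true v l"
    unfolding implies_def by blast
  let ?v = "v(x := \<not> v x)"
  have "\<not> satisfies v (xor_cnf (L i))" using imp v unfolding implies_def by blast
  then have "satisfies ?v (xor_cnf (L i))" 
    using satisfies_xor_cnf_flip[OF dist[OF i(1)] i(2)] by blast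
  moreover have "satisfies ?v (xor_cnf (L j))" if "j \<in> S" "j \<noteq> i" for j

    using satisfies_xor_cnf_fresh[of x "L j"] uniq[of j] v(1) that by blast
  ultimately have "\<forall>j\<in>S. satisfies ?v (xor_cnf (L j))" by metis
  then obtain l where l: "l \<in> C" "lit_true ?v l" using imp unfolding implies_def by blast
  with v have "\<not> lit_true v l" by blast
  with l have "var_of l = x" by (cases l) (auto split: if_splits)
  with l show "x \<in> var_of ` C" by blast
qed

lemma minimal_implies:
  assumes "finite S" "implies L S C"
  shows "\<exists>S'\<subseteq>S. implies L S' C \<and> (\<forall>i\<in>S'. \<not> implies L (S' - {i}) C)"
proof -
  let ?A = "{T. T \<subseteq> S \<and> implies L T C}"
  have "finite ?A" "?A \<noteq> {}" using assms by auto
  from finite_has_minimal[OF this] obtain T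
    where T: "T \<in> ?A" and min: "\<forall>U\<in>?A. U \<subseteq> T \<longrightarrow> T = U" ..
  have nimp: "\<not> implies L (T - {i}) C" if "i \<in> T" for i
  proof
    assume "implies L (T - {i}) C"
    with T have "T - {i} \<in> ?A" by blast
    with min Diff_subset[of T "{i}"] have "T = T - {i}" by (auto simp del: Diff_subset)
    then show False using that by (metis Diff_iff singletonI)
  qed
  with T show ?thesis by blast
qed

text \<open>\<open>\<mu>\<close> is a complexity measure. In width \<open>w\<close> every derived
  clause follows from a set of measure at most \<open>r\<close>: a resolvent follows from the union
  of two such sets, of measure at most \<open>2 * r\<close>, and a minimal subset of measure above
  \<open>r\<close> would force more than \<open>w\<close> boundary variables into the
  clause.\<close>

theorem width_lower_bound:
  fixes L :: "'i \<Rightarrow> 'v literal list" and \<mu> :: "'i set \<Rightarrow> nat"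
  assumes I: "finite I" and dist: "\<And>i. i \<in> I \<Longrightarrow> distinct (map var_of (L i))"
    and mono: "\<And>S T. S \<subseteq> T \<Longrightarrow> T \<subseteq> I \<Longrightarrow> \<mu> S \<le> \<mu> T"
    and subadd: "\<And>S T. S \<subseteq> I \<Longrightarrow> T \<subseteq> I \<Longrightarrow> \<mu> (S \<union> T) \<le> \<mu> S + \<mu> T"
    and single: "\<And>i. i \<in> I \<Longrightarrow> \<mu> {i} \<le> r"
    and small: "\<And>S. S \<subseteq> I \<Longrightarrow> S \<noteq> {} \<Longrightarrow> \<mu> S \<le> r \<Longrightarrow> boundary L S \<noteq> {}"
    and expand: "\<And>S. S \<subseteq> I \<Longrightarrow> r < \<mu> S \<Longrightarrow> \<mu> S \<le> 2 * r \<Longrightarrow>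
      finite (boundary L S) \<Longrightarrow> w < card (boundary L S)"
  shows "\<not> der (\<Union>i\<in>I. xor_cnf (L i)) (clauses_le w) {}"
proof
  have *: "\<exists>S\<subseteq>I. implies L S C \<and> \<mu> S \<le> r"
    if "der (\<Union>i\<in>I. xor_cnf (L i)) (clauses_le w) C" for C
    using that
  proof (induction rule: der.induct)
    case (ax D C)
    then obtain i where "i \<in> I" "D \<in> xor_cnf (L i)" by blast
    moreover from this have "implies L {i} C"
      using ax(2) unfolding implies_def satisfies_def by (metis singletonI subsetD)
    ultimately show ?case
      using single by (intro exI[of _ "{i}"]) auto
  next
    case (res C1 C2 l C)
    then obtain S1 S2 where S: "S1 \<subseteq> I" "implies L S1 C1" "\<mu> S1 \<le> r"
      "S2 \<subseteq> I" "implies L S2 C2" "\<mu> S2 \<le> r" by blast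
    have imp: "implies L (S1 \<union> S2) C"
      unfolding implies_def
    proof (intro allI impI)
      fix v assume "\<forall>i\<in>S1 \<union> S2. satisfies v (xor_cnf (L i))"
      with S obtain l1 l2 where "l1 \<in> C1" "lit_true v l1" "l2 \<in> C2" "lit_true v l2"
        unfolding implies_def by (metis UnCI)
      moreover from this have "l1 \<noteq> l \<or> l2 \<noteq> neg l" by auto
      ultimately show "\<exists>l\<in>C. lit_true v l" using res.hyps by blast
    qed
    have "finite (S1 \<union> S2)" using S I finite_subset by auto
    from minimal_implies[OF this imp] obtain S where S': "S \<subseteq> S1 \<union> S2" "implies L S C"
      "\<forall>i\<in>S. \<not> implies L (S - {i}) C" by blast
    have SI: "S \<subseteq> I" using S' S by blast
    have "\<mu> S \<le> \<mu> (S1 \<union> S2)" using mono[OF S'(1)] S by blast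
    also have "\<dots> \<le> 2 * r" using subadd[of S1 S2] S by simp
    finally have le: "\<mu> S \<le> 2 * r" .
    have C: "finite C" "card C \<le> w" using res.hyps by (auto simp: clauses_le_def)
    have sub: "boundary L S \<subseteq> var_of ` C"
      by (rule boundary_subset_vars[OF S'(2,3)]) (use dist SI in blast)
    then have "finite (boundary L S)" using C finite_subset by blast
    moreover have "card (boundary L S) \<le> w"
      using card_mono[OF _ sub] card_image_le[of C var_of] C by fastforce
    ultimately have "\<mu> S \<le> r" using expand[OF SI _ le] by (meson not_le)
    then show ?case using SI S' by blast
  qed
  assume "der (\<Union>i\<in>I. xor_cnf (L i)) (clauses_le w) {}"
  from *[OF this] obtain S0 where S0: "S0 \<subseteq> I" "implies L S0 {}" "\<mu> S0 \<le> r" by blast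
  then have "finite S0" using I finite_subset by blast
  from minimal_implies[OF this S0(2)] obtain S where S: "S \<subseteq> S0" "implies L S {}"
    "\<forall>i\<in>S. \<not> implies L (S - {i}) {}" by blast
  have SI: "S \<subseteq> I" using S S0 by blast
  \<comment> \<open>For the empty clause the boundary is empty, so \<open>small\<close> leaves only
    \<open>S = {}\<close>, and the empty set of constraints does not imply the empty clause.\<close>
  have "boundary L S \<subseteq> var_of ` {}"
    by (rule boundary_subset_vars[OF S(2,3)]) (use dist SI in blast)
  moreover have "\<mu> S \<le> r" using mono[OF S(1) S0(1)] S0(3) by linarith
  ultimately have "S = {}" using small[OF SI] by auto
  with S(2) show False by (simp add: implies_def)
qed

section \<open>Mixing of random permutations\<close>

text \<open>\<open>b\<close> acts as an entry in front of the list, so a list of given length is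
  determined by the places of its changes; few changes mean few possible lists.\<close>

primrec changes :: "bool \<Rightarrow> bool list \<Rightarrow> nat" where
  "changes b [] = 0"
| "changes b (y # ys) = of_bool (b \<noteq> y) + changes y ys"

lemma changes_triangle: "changes b ys \<le> of_bool (b \<noteq> b') + changes b' ys"
  by (cases ys) auto

text \<open>Deleting an entry merges two transitions into one, which the triangle inequality
  bounds.\<close>

lemma changes_filter: "changes b (map f (filter g xs)) \<le> changes b (map f xs)"
proof (induction xs arbitrary: b)
  case (Cons x xs)
  show ?case
    using Cons[of "f x"] order_trans[OF Cons[of b] changes_triangle[of b _ "f x"]] by auto
qed simp

text \<open>\<open>(b # ys) ! i\<close> is the entry before \<open>ys ! i\<close>. In this form
  changes are matched with cut edges in \<open>changes_hosted\<close>.\<close>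

lemma changes_conv_card: "changes b ys = card {i. i < length ys \<and> ys ! i \<noteq> (b # ys) ! i}"
proof (induction ys arbitrary: b)
  case (Cons y ys)
  let ?A = "\<lambda>b ys. {i. i < length ys \<and> ys ! i \<noteq> (b # ys) ! i}"
  have "?A b (y # ys) = {i. i = 0 \<and> b \<noteq> y} \<union> Suc ` ?A y ys"
  proof (intro set_eqI)
    fix i show "i \<in> ?A b (y # ys) \<longleftrightarrow> i \<in> {i. i = 0 \<and> b \<noteq> y} \<union> Suc ` ?A y ys"
      by (cases i) auto
  qed
  moreover have "card ({i. i = 0 \<and> b \<noteq> y} \<union> Suc ` ?A y ys)
      = card {i::nat. i = 0 \<and> b \<noteq> y} + card (Suc ` ?A y ys)"
    by (rule card_Un_disjoint) auto
  ultimately show ?case by (simp add: Cons card_image)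
qed simp

text \<open>After any bit, one choice of the next bit is a change and the other is not, so each
  position contributes a factor \<open>1 + x\<close>.\<close>

lemma sum_power_changes:
  fixes x :: real
  shows "(\<Sum>ys | length ys = k. x ^ changes b ys) = (1 + x) ^ k"
proof (induction k arbitrary: b)
  case (Suc k)
  have fin: "finite {ys :: bool list. length ys = k}"
    using finite_lists_length_eq[of "UNIV :: bool set" k] by simp
  have "{ys :: bool list. length ys = Suc k} = (\<lambda>(y, ys). y # ys) ` (UNIV \<times> {ys. length ys = k})"
    by (auto simp: length_Suc_conv)
  then have "(\<Sum>ys | length ys = Suc k. x ^ changes b ys)
      = (\<Sum>(y, ys)\<in>UNIV \<times> {ys. length ys = k}. x ^ changes b (y # ys))"
    by (simp add: sum.reindex inj_on_def case_prod_beta)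
  also have "\<dots> = (\<Sum>y\<in>UNIV. \<Sum>ys | length ys = k. x ^ changes b (y # ys))"
    using fin by (simp add: sum.cartesian_product)
  also have "\<dots> = (\<Sum>y\<in>UNIV. x ^ of_bool (b \<noteq> y) * (1 + x) ^ k)"
    by (simp add: power_add sum_distrib_left[symmetric] Suc del: UNIV_bool)
  also have "\<dots> = (1 + x) ^ Suc k"
    by (cases b) (auto simp: UNIV_bool algebra_simps)
  finally show ?case .
qed simp

section \<open>Generating functions over subsets and the counting bounds they give\<close>

lemma sum_Pow_insert:
  assumes "finite X" "a \<notin> X"
  shows "(\<Sum>T\<in>Pow (insert a X). f T) = (\<Sum>T\<in>Pow X. f T + f (insert a T))"
proof -
  have "(\<Sum>T\<in>Pow (insert a X). f T) = (\<Sum>T\<in>Pow X. f T) + (\<Sum>T\<in>insert a ` Pow X. f T)"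
    unfolding Pow_insert by (rule sum.union_disjoint) (use assms in auto)
  also have "(\<Sum>T\<in>insert a ` Pow X. f T) = (\<Sum>T\<in>Pow X. f (insert a T))"
  proof (rule sum.reindex_cong[OF _ refl refl])
    show "inj_on (insert a) (Pow X)" using assms(2) by (auto simp: inj_on_def insert_ident)
  qed
  finally show ?thesis by (simp add: sum.distrib)
qed

lemma sum_power_card_Pow:
  fixes x :: real
  assumes "finite X"
  shows "(\<Sum>T\<in>Pow X. x ^ card T) = (1 + x) ^ card X"
  using assms
proof (induction X rule: finite_induct)
  case (insert a X)
  have "(\<Sum>T\<in>Pow (insert a X). x ^ card T) = (\<Sum>T\<in>Pow X. (1 + x) * x ^ card T)"
    unfolding sum_Pow_insert[OF insert(1,2)]
  proof (rule sum.cong[OF refl])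
    fix T assume "T \<in> Pow X"
    then have "finite T" "a \<notin> T" using insert finite_subset[of T X] by auto
    then show "x ^ card T + x ^ card (insert a T) = (1 + x) * x ^ card T"
      by (simp add: algebra_simps)
  qed
  then show ?case using insert by (simp add: sum_distrib_left[symmetric])
qed simp

text \<open>Of the four ways to place an element relative to \<open>A\<close> and \<open>B\<close>,
  only membership in both contributes a factor \<open>x\<close>.\<close>

lemma sum_power_card_Int:
  fixes x :: real
  assumes "finite X"
  shows "(\<Sum>A\<in>Pow X. \<Sum>B\<in>Pow X. x ^ card (A \<inter> B)) = (3 + x) ^ card X"
  using assms
proof (induction X rule: finite_induct)
  case (insert a X)
  have "(\<Sum>A\<in>Pow (insert a X). \<Sum>B\<in>Pow (insert a X). x ^ card (A \<inter> B))
      = (\<Sum>A\<in>Pow X. \<Sum>B\<in>Pow X. (3 + x) * x ^ card (A \<inter> B))"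
    unfolding sum_Pow_insert[OF insert(1,2)] sum.distrib[symmetric]
  proof (intro sum.cong refl)
    fix A B assume "A \<in> Pow X" "B \<in> Pow X"
    then have "a \<notin> A" "a \<notin> B" "finite (A \<inter> B)"
      using insert finite_subset[of A X] by auto
    then show "x ^ card (A \<inter> B) + x ^ card (A \<inter> insert a B)
        + (x ^ card (insert a A \<inter> B) + x ^ card (insert a A \<inter> insert a B))
        = (3 + x) * x ^ card (A \<inter> B)"
      by (simp add: algebra_simps)
  qed
  then show ?case using insert by (simp add: sum_distrib_left[symmetric])
qed simp

text \<open>Markov's inequality in exponential form: as \<open>x \<le> 1\<close>, each counted
  \<open>s\<close> contributes at least \<open>x ^ c\<close>.\<close>

lemma card_le_generating_function:
  fixes x :: real
  assumes "finite S" "0 < x" "x \<le> 1"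
  shows "real (card {s \<in> S. f s \<le> c}) * x ^ c \<le> (\<Sum>s\<in>S. x ^ f s)"
proof -
  have "real (card {s \<in> S. f s \<le> c}) * x ^ c = (\<Sum>s | s \<in> S \<and> f s \<le> c. x ^ c)" by simp
  also have "\<dots> \<le> (\<Sum>s | s \<in> S \<and> f s \<le> c. x ^ f s)"
    using assms by (intro sum_mono power_decreasing) auto
  also have "\<dots> \<le> (\<Sum>s\<in>S. x ^ f s)"
    using assms by (intro sum_mono2) auto
  finally show ?thesis .
qed

text \<open>For \<open>2 * i \<le> k\<close> the estimate
  \<open>(k / i) ^ i \<le> k choose i\<close> gives \<open>2 ^ i\<close>; larger \<open>j\<close>
  follow by symmetry of the binomial coefficients.\<close>

lemma two_power_le_binomial:
  assumes "m \<le> j" "m + j \<le> k"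
  shows "2 ^ m \<le> k choose j"
proof -
  have half: "2 ^ i \<le> k choose i" if "2 * i \<le> k" for i k :: nat
  proof (cases "i = 0")
    case False
    have "(2 :: real) ^ i \<le> (real k / real i) ^ i"
      using that False by (intro power_mono) (auto simp: field_simps simp flip: of_nat_mult)
    also have "\<dots> \<le> real (k choose i)"
      using that binomial_ge_n_over_k_pow_k[of i k, where 'a = real] by simp
    finally have "real (2 ^ i) \<le> real (k choose i)" by simp
    then show ?thesis by (simp only: of_nat_le_iff)
  qed simp
  show ?thesis
  proof (cases "2 * j \<le> k")
    case True
    have "(2::nat) ^ m \<le> 2 ^ j" using assms by (intro power_increasing) auto
    with half[OF True] show ?thesis by linarith
  next
    case False
    have "(2::nat) ^ m \<le> 2 ^ (k - j)" using assms by (intro power_increasing) auto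
    also have "\<dots> \<le> k choose (k - j)" by (rule half) (use False in simp)
    also have "\<dots> = k choose j" using assms by (simp add: binomial_symmetric[of j k])
    finally show ?thesis .
  qed
qed

text \<open>The classes of permutations with a given pattern of a \<open>j\<close>-subset of \<open>D\<close> have the same size
  for all \<open>j\<close>-subsets, because the symmetric group of \<open>D\<close> permutes them transitively.\<close>

lemma card_permutations_pattern:
  assumes B: "finite B" and D: "D \<subseteq> B" and R: "R \<subseteq> D"
  shows "card {bs \<in> permutations_of_set B. map (\<lambda>x. x \<in> R) (filter (\<lambda>x. x \<in> D) bs) = q}
           * (card D choose card R) \<le> fact (card B)"
proof -
  define E where
    "E R = {bs \<in> permutations_of_set B. map (\<lambda>x. x \<in> R) (filter (\<lambda>x. x \<in> D) bs) = q}" for R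
  have finD: "finite D" using B D finite_subset by blast
  have finE: "finite (E R')" for R' by (simp add: E_def)
  have le: "card (E R) \<le> card (E R')" if R': "R' \<subseteq> D" "card R' = card R" for R'
  proof -
    have fin: "finite R" "finite R'" using R R' finD finite_subset by auto
    then obtain g where g: "bij_betw g R R'"
      using finite_same_card_bij R' by metis
    have "card (D - R) = card (D - R')"
      using R R' fin by (simp add: card_Diff_subset)
    then obtain h where h: "bij_betw h (D - R) (D - R')"
      using finite_same_card_bij[of "D - R" "D - R'"] finD by auto
    \<comment> \<open>\<open>f\<close> permutes \<open>D\<close>, carries \<open>R\<close> to
      \<open>R'\<close> and fixes \<open>B - D\<close>. Applied entrywise it keeps the positions of
      \<open>D\<close> in the list and turns pattern \<open>q\<close> for \<open>R\<close> into
      pattern \<open>q\<close> for \<open>R'\<close>.\<close>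
    define f where "f x = (if x \<in> R then g x else if x \<in> D then h x else x)" for x
    have f1: "bij_betw f R R'" using g by (simp add: f_def cong: bij_betw_cong)
    have f2: "bij_betw f (D - R) (D - R')"
    proof -
      have "bij_betw f (D - R) (D - R') = bij_betw h (D - R) (D - R')"
        by (rule bij_betw_cong) (auto simp: f_def)
      with h show ?thesis by simp
    qed
    have f3: "bij_betw f (B - D) (B - D)"
    proof -
      have "bij_betw f (B - D) (B - D) = bij_betw id (B - D) (B - D)"
        by (rule bij_betw_cong) (use R in \<open>auto simp: f_def\<close>)
      then show ?thesis by simp
    qed
    have fD: "bij_betw f D D"
      using bij_betw_combine[OF f1 f2] R R' by (simp add: Un_absorb1)
    have fB: "bij_betw f B B"
      using bij_betw_combine[OF fD f3] D by (simp add: Un_absorb1)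
    have mem: "f x \<in> R' \<longleftrightarrow> x \<in> R" if "x \<in> D" for x
      using that f1 f2 by (cases "x \<in> R") (auto dest: bij_betwE)
    have memD: "f x \<in> D \<longleftrightarrow> x \<in> D" if "x \<in> B" for x
      using that fD f3 by (cases "x \<in> D") (auto dest: bij_betwE)
    have inj: "inj_on (map f) (E R)"
    proof (rule inj_onI)
      fix bs bs' assume *: "bs \<in> E R" "bs' \<in> E R" "map f bs = map f bs'"
      then have "set bs = B" "set bs' = B" by (auto simp: E_def dest: permutations_of_setD)
      with * show "bs = bs'"
        using fB by (intro map_inj_on[of f bs bs']) (auto simp: bij_betw_def)
    qed
    have "map f ` E R \<subseteq> E R'"
    proof
      fix cs assume "cs \<in> map f ` E R"
      then obtain bs where bs: "bs \<in> E R" "cs = map f bs" by blast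
      then have perm: "set bs = B" "distinct bs"
        by (auto simp: E_def dest: permutations_of_setD)
      have "cs \<in> permutations_of_set B"
        using perm fB bs(2) by (intro permutations_of_setI) (auto simp: distinct_map bij_betw_def)
      moreover have "filter (\<lambda>x. x \<in> D) cs = map f (filter (\<lambda>x. x \<in> D) bs)"
        unfolding bs(2) filter_map o_def
        by (rule arg_cong[of _ _ "map f"], rule filter_cong) (use memD perm in auto)
      then have "map (\<lambda>x. x \<in> R') (filter (\<lambda>x. x \<in> D) cs) = q"
        using bs(1) mem by (auto simp: E_def)
      ultimately show "cs \<in> E R'" by (simp add: E_def)
    qed
    then show ?thesis
      using inj card_inj_on_le finE by blast
  qed
  let ?RR = "{R'. R' \<subseteq> D \<and> card R' = card R}"
  \<comment> \<open>The classes \<open>E R'\<close> are disjoint, because \<open>bs\<close> and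
    \<open>q\<close> together determine \<open>R'\<close>; each is at least as large as
    \<open>E R\<close>.\<close>
  have "card (E R) * (card D choose card R) = (\<Sum>R'\<in>?RR. card (E R))"
    using n_subsets[OF finD, of "card R"] by simp
  also have "\<dots> \<le> (\<Sum>R'\<in>?RR. card (E R'))"
    by (rule sum_mono) (use le in auto)
  also have "\<dots> = card (\<Union>R'\<in>?RR. E R')"
  proof (rule card_UN_disjoint[symmetric])
    show "finite ?RR" using finD by auto
    show "\<forall>R'\<in>?RR. \<forall>R''\<in>?RR. R' \<noteq> R'' \<longrightarrow> E R' \<inter> E R'' = {}"
    proof (intro ballI impI equals0I)
      fix R1 R2 bs assume *: "R1 \<in> ?RR" "R2 \<in> ?RR" "R1 \<noteq> R2" "bs \<in> E R1 \<inter> E R2"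
      then have "set bs = B" by (auto simp: E_def dest: permutations_of_setD)
      moreover have "map (\<lambda>x. x \<in> R1) (filter (\<lambda>x. x \<in> D) bs)
          = map (\<lambda>x. x \<in> R2) (filter (\<lambda>x. x \<in> D) bs)"
        using * by (simp add: E_def)
      ultimately have "x \<in> R1 \<longleftrightarrow> x \<in> R2" if "x \<in> D" for x
        using that D by (auto simp: map_eq_conv)
      with * show False by auto
    qed
  qed (use finE in auto)
  also have "\<dots> \<le> card (permutations_of_set B)"
    by (rule card_mono) (auto simp: E_def)
  also have "\<dots> = fact (card B)" using B by simp
  finally show ?thesis by (simp add: E_def)
qed

text \<open>\<open>P\<close> and \<open>Q\<close> play the role of the variables whose constraint in the first, respectively second,
  chain belongs to a given set of constraints.\<close>

definition well_mixed :: "nat \<Rightarrow> nat \<Rightarrow> 'a set \<Rightarrow> 'a list \<Rightarrow> 'a list \<Rightarrow> bool" where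
  "well_mixed c r D as bs \<longleftrightarrow> (\<forall>P Q.
     changes False (map (\<lambda>x. x \<in> P) as) + changes False (map (\<lambda>x. x \<in> Q) bs)
       + card {x \<in> D. (x \<in> P) \<noteq> (x \<in> Q)} \<le> c \<longrightarrow>
     \<not> (r < card (D \<inter> P) \<and> card (D \<inter> P) \<le> 2 * r))"

text \<open>Union bound over triples \<open>(P, T, q)\<close>: the first trace on \<open>D\<close>,
  the set where the two traces disagree, and the second trace read along \<open>bs\<close>. Each
  component has at most \<open>M\<close> values. For a fixed triple, at most a share
  \<open>1 / 2 ^ (r - c)\<close> of the orders gives the fixed set \<open>sym_diff P T\<close> the
  pattern \<open>q\<close>. The parameter \<open>x\<close> is left open for tuning.\<close>

theorem card_not_well_mixed:
  fixes x :: real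
  assumes B: "finite B" and D: "D \<subseteq> B" "D \<subseteq> set as" and as: "distinct as"
    and r: "3 * r \<le> card D" and x: "0 < x" "x \<le> 1"
  shows "real (card {bs \<in> permutations_of_set B. \<not> well_mixed c r D as bs}) * 2 ^ (r - c)
           \<le> ((1 + x) ^ card D / x ^ c) ^ 3 * fact (card B)"
proof -
  define k where "k = card D"
  define M where "M = (1 + x) ^ k / x ^ c"
  define ds where "ds = filter (\<lambda>x. x \<in> D) as"
  define E where
    "E R q = {bs \<in> permutations_of_set B. map (\<lambda>x. x \<in> R) (filter (\<lambda>x. x \<in> D) bs) = q}" for R q
  define PP where "PP = {P. P \<subseteq> D \<and> changes False (map (\<lambda>x. x \<in> P) ds) \<le> c
    \<and> r < card P \<and> card P \<le> 2 * r}"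
  define TT where "TT = {T \<in> Pow D. card T \<le> c}"
  define LL where "LL = {q \<in> {q. length q = k}. changes False q \<le> c}"
  have finD: "finite D" using B D finite_subset by blast
  have ds: "set ds = D" "distinct ds"
    using D as by (auto simp: ds_def)
  then have length_ds: "length ds = k"
    using distinct_card[of ds] by (simp add: k_def)
  have finL: "finite {q :: bool list. length q = k}"
    using finite_lists_length_eq[of "UNIV :: bool set" k] by simp
  have fin: "finite PP" "finite TT" "finite LL"
    using finD finL by (auto simp: PP_def TT_def LL_def)
  have LL: "real (card LL) \<le> M"
    using card_le_generating_function[OF finL x, of "changes False" c] x
    by (simp add: sum_power_changes LL_def M_def field_simps)
  have TT: "real (card TT) \<le> M"
    using card_le_generating_function[of "Pow D" x card c] x finD
    by (simp add: sum_power_card_Pow TT_def M_def k_def field_simps)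
  have "card PP \<le> card LL"
  proof (rule card_inj_on_le)
    show "inj_on (\<lambda>P. map (\<lambda>x. x \<in> P) ds) PP"
      using ds by (auto simp: inj_on_def PP_def map_eq_conv)
    show "(\<lambda>P. map (\<lambda>x. x \<in> P) ds) ` PP \<subseteq> LL"
      using length_ds by (auto simp: PP_def LL_def)
  qed (use fin in simp)
  with LL have PP: "real (card PP) \<le> M" by linarith
  have sub: "{bs \<in> permutations_of_set B. \<not> well_mixed c r D as bs}
      \<subseteq> (\<Union>(P, T, q)\<in>PP \<times> TT \<times> LL. E (sym_diff P T) q)"
  proof
    fix bs assume bs: "bs \<in> {bs \<in> permutations_of_set B. \<not> well_mixed c r D as bs}"
    then obtain P Q where PQ: "changes False (map (\<lambda>x. x \<in> P) as)
        + changes False (map (\<lambda>x. x \<in> Q) bs) + card {x \<in> D. (x \<in> P) \<noteq> (x \<in> Q)} \<le> c"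
      "r < card (D \<inter> P)" "card (D \<inter> P) \<le> 2 * r"
      unfolding well_mixed_def by blast
    define T where "T = {x \<in> D. (x \<in> P) \<noteq> (x \<in> Q)}"
    define q where "q = map (\<lambda>x. x \<in> Q) (filter (\<lambda>x. x \<in> D) bs)"
    have set_bs: "set bs = B" "distinct bs" using bs by (auto dest: permutations_of_setD)
    have "map (\<lambda>x. x \<in> D \<inter> P) ds = map (\<lambda>x. x \<in> P) ds" using ds by auto
    moreover have "changes False (map (\<lambda>x. x \<in> P) ds) \<le> c"
      unfolding ds_def using PQ(1) changes_filter[of False "\<lambda>x. x \<in> P" "\<lambda>x. x \<in> D" as] by linarith
    ultimately have "changes False (map (\<lambda>x. x \<in> D \<inter> P) ds) \<le> c" by metis
    then have "D \<inter> P \<in> PP" using PQ by (simp add: PP_def)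
    moreover have "T \<in> TT" using PQ(1) by (auto simp: TT_def T_def)
    moreover have "q \<in> LL"
    proof -
      have "length q = k"
        using set_bs D distinct_card[of "filter (\<lambda>x. x \<in> D) bs"]
        by (simp add: q_def k_def Int_absorb1 Int_def[symmetric] Int_commute)
      moreover have "changes False q \<le> c"
        using PQ(1) changes_filter[of False "\<lambda>x. x \<in> Q" "\<lambda>x. x \<in> D" bs] by (simp add: q_def)
      ultimately show ?thesis by (simp add: LL_def)
    qed
    \<comment> \<open>On \<open>D\<close>, the set \<open>Q\<close> agrees with
      \<open>sym_diff (D \<inter> P) T\<close>.\<close>
    moreover have "bs \<in> E (sym_diff (D \<inter> P) T) q"
      using bs by (auto simp: E_def q_def T_def)
    ultimately show "bs \<in> (\<Union>(P, T, q)\<in>PP \<times> TT \<times> LL. E (sym_diff P T) q)" by blast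
  qed
  have each: "real (card (E (sym_diff P T) q)) * 2 ^ (r - c) \<le> fact (card B)"
    if "P \<in> PP" "T \<in> TT" for P T q
  proof -
    let ?R = "sym_diff P T"
    have PT: "P \<subseteq> D" "T \<subseteq> D" "r < card P" "card P \<le> 2 * r" "card T \<le> c"
      using that by (auto simp: PP_def TT_def)
    then have finPT: "finite P" "finite T" using finD finite_subset by auto
    have "card P \<le> card (?R \<union> T)" using finPT by (intro card_mono) auto
    also have "\<dots> \<le> card ?R + card T" by (rule card_Un_le)
    finally have lower: "r - c \<le> card ?R" using PT by linarith
    \<comment> \<open>\<open>3 * r \<le> card D\<close> leaves at least \<open>r - c\<close>
      elements of \<open>D\<close> outside \<open>?R\<close>. If \<open>r < c\<close>, the truncated
      difference is 0 and \<open>?R \<subseteq> D\<close> suffices.\<close>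
    have "card ?R \<le> card (P \<union> T)" using finPT by (intro card_mono) auto
    also have "\<dots> \<le> card P + card T" by (rule card_Un_le)
    finally have upper: "r - c + card ?R \<le> card D \<or> r < c" using PT r by linarith
    have Rsub: "?R \<subseteq> D" using PT by auto
    have "r - c + card ?R \<le> card D"
      using upper card_mono[OF finD Rsub] by auto
    from two_power_le_binomial[OF lower this]
    have "card (E ?R q) * 2 ^ (r - c) \<le> card (E ?R q) * (card D choose card ?R)" by simp
    also have "\<dots> \<le> fact (card B)"
      unfolding E_def by (rule card_permutations_pattern[OF B D(1) Rsub])
    finally have "real (card (E ?R q) * 2 ^ (r - c)) \<le> real (fact (card B))"
      by (simp only: of_nat_le_iff)
    then show ?thesis by simp
  qed
  have "card {bs \<in> permutations_of_set B. \<not> well_mixed c r D as bs}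
      \<le> card (\<Union>(P, T, q)\<in>PP \<times> TT \<times> LL. E (sym_diff P T) q)"
    by (rule card_mono[OF _ sub]) (use fin in \<open>auto simp: E_def\<close>)
  also have "\<dots> \<le> (\<Sum>(P, T, q)\<in>PP \<times> TT \<times> LL. card (E (sym_diff P T) q))"
    using card_UN_le[of "PP \<times> TT \<times> LL" "\<lambda>(P, T, q). E (sym_diff P T) q"] fin
    by (simp add: case_prod_beta)
  finally have "real (card {bs \<in> permutations_of_set B. \<not> well_mixed c r D as bs})
      \<le> (\<Sum>(P, T, q)\<in>PP \<times> TT \<times> LL. real (card (E (sym_diff P T) q)))"
    by (simp add: case_prod_beta flip: of_nat_sum)
  then have "real (card {bs \<in> permutations_of_set B. \<not> well_mixed c r D as bs}) * 2 ^ (r - c)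
      \<le> (\<Sum>(P, T, q)\<in>PP \<times> TT \<times> LL. real (card (E (sym_diff P T) q))) * 2 ^ (r - c)"
    by (rule mult_right_mono) simp
  also have "\<dots> = (\<Sum>(P, T, q)\<in>PP \<times> TT \<times> LL. real (card (E (sym_diff P T) q)) * 2 ^ (r - c))"
    by (simp add: sum_distrib_right case_prod_beta)
  also have "\<dots> \<le> (\<Sum>(P, T, q)\<in>PP \<times> TT \<times> LL. fact (card B))"
    by (rule sum_mono) (use each in auto)
  also have "\<dots> = real (card PP) * real (card TT) * real (card LL) * fact (card B)"
    by (simp add: case_prod_beta card_cartesian_product)
  also have "\<dots> \<le> M * M * M * fact (card B)"
    using PP TT LL by (intro mult_right_mono mult_mono) auto
  finally show ?thesis by (simp add: M_def k_def power3_eq_cube)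
qed

section \<open>The Tseitin graph of the formula\<close>

lemma signed_clause_facts:
  assumes "C \<in> xor_cnf ys"
  shows "finite C" "card C \<le> length ys" "var_of ` C = var_of ` set ys"
proof -
  obtain N where N: "C = signed_clause ys N" using assms by (auto simp: xor_cnf_def)
  show "finite C" by (simp add: N signed_clause_def)
  show "card C \<le> length ys"
    unfolding N signed_clause_def by (rule order_trans[OF card_image_le]) simp_all
  have "var_of ` C = (\<lambda>i. var_of (ys ! i)) ` {..<length ys}"
    unfolding N signed_clause_def image_image by (rule image_cong) auto
  also have "\<dots> = var_of ` (\<lambda>i. ys ! i) ` {..<length ys}" by (simp add: image_image)
  also have "(\<lambda>i. ys ! i) ` {..<length ys} = set ys" by (auto simp: set_conv_nth)
  finally show "var_of ` C = var_of ` set ys" .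
qed

text \<open>Two end constraints and \<open>m - 4\<close> inner ones make \<open>m - 2\<close>. A
  short list, even the empty one, is a single constraint.\<close>

definition parity_vertices :: "nat \<Rightarrow> nat" where
  "parity_vertices m = (if m < 4 then 1 else m - 2)"

text \<open>Constraint \<open>p\<close> contains \<open>t p\<close> and \<open>t (p + 1)\<close> as
  far as they exist, so \<open>t j\<close> is the path edge from constraint \<open>j - 1\<close> to
  \<open>j\<close>.\<close>

definition parity_block :: "(nat \<Rightarrow> 'v) \<Rightarrow> 'v literal list \<Rightarrow> nat \<Rightarrow> 'v literal list" where
  "parity_block t ys p = (let m = length ys in
     if m < 4 then ys
     else if p = 0 then [ys ! 0, ys ! 1, Pos (t 1)]
     else if p = m - 3 then [Pos (t (m - 3)), ys ! (m - 2), ys ! (m - 1)]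
     else [Pos (t p), ys ! (p + 1), Pos (t (p + 1))])"

text \<open>The index of the constraint that contains the literal at position \<open>i\<close> of a list of length
  \<open>m\<close>; the truncated subtraction puts the first two literals into constraint 0.\<close>

definition host :: "nat \<Rightarrow> nat \<Rightarrow> nat" where
  "host m i = min (i - 1) (parity_vertices m - 1)"

lemma parity_vertices_pos: "0 < parity_vertices m"
  by (simp add: parity_vertices_def)

lemma host_less: "host m i < parity_vertices m"
  using parity_vertices_pos[of m] by (auto simp: host_def min_def)

lemma parity_cnf_blocks:
  "parity_cnf t ys = (\<Union>p<parity_vertices (length ys). xor_cnf (parity_block t ys p))"
proof (cases "length ys < 4")
  case True
  then show ?thesis by (simp add: parity_cnf_def parity_vertices_def parity_block_def lessThan_Suc)
next
  case False
  define m where "m = length ys"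
  have m: "4 \<le> m" using False by (simp add: m_def)
  then have *: "{..<parity_vertices m} = {0} \<union> {1..m - 4} \<union> {m - 3}"
    by (auto simp: parity_vertices_def)
  have "(\<Union>j\<in>{1..m - 4}. xor_cnf [Pos (t j), ys ! (j + 1), Pos (t (j + 1))])
      = (\<Union>j\<in>{1..m - 4}. xor_cnf (parity_block t ys j))"
    using m by (intro SUP_cong) (auto simp: parity_block_def Let_def simp flip: m_def)
  moreover have "xor_cnf [ys ! 0, ys ! 1, Pos (t 1)] = xor_cnf (parity_block t ys 0)"
    "xor_cnf [Pos (t (m - 3)), ys ! (m - 2), ys ! (m - 1)] = xor_cnf (parity_block t ys (m - 3))"
    using m by (auto simp: parity_block_def Let_def simp flip: m_def)
  ultimately show ?thesis
    unfolding m_def[symmetric] * using m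
    by (simp only: parity_cnf_def Let_def m_def[symmetric] UN_Un UN_insert UN_empty not_less[symmetric]
        if_False Un_empty_right)
qed

lemma length_parity_block: "length (parity_block t ys p) \<le> 3"
  by (simp add: parity_block_def Let_def)

text \<open>The path structure in uniform form: the bounds on \<open>j\<close> drop the missing edge
  at each end, and all edges for short lists. Later arguments thus avoid the case distinctions of
  the encoding.\<close>

lemma vars_parity_block:
  assumes "p < parity_vertices (length ys)"
  shows "var_of ` set (parity_block t ys p) =
    t ` {j. (j = p \<or> j = p + 1) \<and> 1 \<le> j \<and> j < parity_vertices (length ys)}
    \<union> {var_of (ys ! i) | i. i < length ys \<and> host (length ys) i = p}"
proof -
  define m where "m = length ys"
  define J where "J = {j. (j = p \<or> j = p + 1) \<and> 1 \<le> j \<and> j < parity_vertices m}"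
  define K where "K = {i. i < m \<and> host m i = p}"
  have "var_of ` set (parity_block t ys p) = t ` J \<union> (\<lambda>i. var_of (ys ! i)) ` K"
  proof (cases "m < 4")
    case True
    then have "J = {}" "K = {..<m}"
      using assms by (auto simp: J_def K_def parity_vertices_def host_def m_def)
    moreover have "set ys = (\<lambda>i. ys ! i) ` {..<m}" by (auto simp: set_conv_nth m_def)
    ultimately show ?thesis
      using True by (simp add: parity_block_def Let_def m_def image_image)
  next
    case False
    then have m: "4 \<le> m" by simp
    have p: "p \<le> m - 3" using assms m by (auto simp: parity_vertices_def m_def)
    consider "p = 0" | "p = m - 3" | "0 < p" "p < m - 3" using p by linarith
    then show ?thesis
    proof cases
      case 1
      then have "J = {1}" "K = {0, 1}"
        using m by (auto simp: J_def K_def parity_vertices_def host_def min_def split: if_splits)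
      then show ?thesis using 1 m by (auto simp: parity_block_def Let_def simp flip: m_def)
    next
      case 2
      then have "J = {m - 3}" "K = {m - 2, m - 1}"
        using m by (auto simp: J_def K_def parity_vertices_def host_def min_def split: if_splits)
      then show ?thesis using 2 m by (auto simp: parity_block_def Let_def simp flip: m_def)
    next
      case 3
      then have "J = {p, p + 1}" "K = {p + 1}"
        using m by (auto simp: J_def K_def parity_vertices_def host_def min_def split: if_splits)
      then show ?thesis using 3 m by (auto simp: parity_block_def Let_def simp flip: m_def)
    qed
  qed
  then show ?thesis by (auto simp: J_def K_def m_def)
qed

lemma distinct_parity_block:
  assumes "distinct (map var_of ys)" "inj t" "range t \<inter> var_of ` set ys = {}"
    and "p < parity_vertices (length ys)"
  shows "distinct (map var_of (parity_block t ys p))"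
proof (cases "length ys < 4")
  case True
  then show ?thesis using assms by (simp add: parity_block_def)
next
  case False
  have neq: "var_of (ys ! i) \<noteq> var_of (ys ! j)" if "i < length ys" "j < length ys" "i \<noteq> j" for i j
    using assms(1) that by (metis distinct_conv_nth length_map nth_map)
  have fresh: "t k \<noteq> var_of (ys ! i)" "var_of (ys ! i) \<noteq> t k" if "i < length ys" for k i
    using assms(3) nth_mem[OF that] by auto
  have "p \<le> length ys - 3" using assms(4) False by (simp add: parity_vertices_def)
  have len: "0 < length ys" "Suc 0 < length ys" "length ys - Suc 0 < length ys"
    "length ys - 2 < length ys" "length ys - 2 \<noteq> length ys - Suc 0" using False by auto
  have ends: "var_of (ys ! 0) \<noteq> var_of (ys ! Suc 0)"
    "var_of (ys ! (length ys - 2)) \<noteq> var_of (ys ! (length ys - Suc 0))"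
    using neq len by auto
  have inj: "t i = t j \<longleftrightarrow> i = j" for i j using assms(2) by (auto simp: inj_def)
  show ?thesis
  proof (cases "p = 0 \<or> p = length ys - 3")
    case True
    then show ?thesis using False len ends fresh by (auto simp: parity_block_def Let_def)
  next
    case False
    then have "p + 1 < length ys" using \<open>p \<le> length ys - 3\<close> by linarith
    then show ?thesis
      using False \<open>\<not> length ys < 4\<close> fresh inj by (auto simp: parity_block_def Let_def)
  qed
qed

section \<open>The three paths of constraints and the traces that a set leaves on them\<close>

locale parity_instance =
  fixes as bs :: "nat list" and z :: nat
  assumes dist: "distinct as" "distinct bs" and z: "z \<in> sym_diff (set as) (set bs)"
begin

definition xs :: "nat \<Rightarrow> nat list" where
  "xs h = (if h = 0 then as else if h = 1 then bs
     else sorted_list_of_set (sym_diff (set as) (set bs)))"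

definition aux :: "nat \<Rightarrow> nat \<Rightarrow> var" where
  "aux h = (if h = 0 then SVar else if h = 1 then TVar else UVar)"

definition lit :: "nat \<Rightarrow> nat \<Rightarrow> var literal" where
  "lit h i = (if h = 2 \<and> i = z then Neg (XVar i) else Pos (XVar i))"

definition block :: "nat \<times> nat \<Rightarrow> var literal list" where
  "block v = parity_block (aux (fst v)) (map (lit (fst v)) (xs (fst v))) (snd v)"

definition num_vertices :: "nat \<Rightarrow> nat" where
  "num_vertices h = parity_vertices (length (xs h))"

text \<open>The constraint \<open>(h, p)\<close> is the one at position \<open>p\<close> in the chain of \<open>A\<close>, \<open>B\<close> or
  \<open>A \<triangle> B\<close>, for \<open>h = 0, 1, 2\<close>.\<close>

definition vertices :: "(nat \<times> nat) set" where
  "vertices = (SIGMA h:{..2}. {..<num_vertices h})"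

text \<open>The trace of \<open>S\<close> on path \<open>h\<close>, recorded by variable indices
  rather than positions so that traces on different paths can be compared.\<close>

definition hosted :: "nat \<Rightarrow> (nat \<times> nat) set \<Rightarrow> nat set" where
  "hosted h S = {x. \<exists>i<length (xs h). xs h ! i = x \<and> (h, host (length (xs h)) i) \<in> S}"

text \<open>The edges of path \<open>h\<close> that leave \<open>S\<close>, since
  \<open>aux h j\<close> joins constraints \<open>j - 1\<close> and \<open>j\<close>.\<close>

definition cut :: "nat \<Rightarrow> (nat \<times> nat) set \<Rightarrow> nat set" where
  "cut h S = {j. 1 \<le> j \<and> j < num_vertices h \<and> ((h, j - 1) \<in> S) \<noteq> ((h, j) \<in> S)}"

lemma distinct_xs: "distinct (xs h)"
  using dist by (simp add: xs_def)

lemma set_xs: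
  "set (xs 0) = set as" "set (xs 1) = set bs" "set (xs 2) = sym_diff (set as) (set bs)"
  by (simp_all add: xs_def)

lemma aux_eq_iff: "h \<le> 2 \<Longrightarrow> h' \<le> 2 \<Longrightarrow> aux h j = aux h' j' \<longleftrightarrow> h = h' \<and> j = j'"
  by (auto simp: aux_def split: if_splits)

lemma aux_neq_XVar [simp]: "aux h j \<noteq> XVar x" "XVar x \<noteq> aux h j"
  by (auto simp: aux_def)

lemma var_of_lit [simp]: "var_of (lit h i) = XVar i"
  by (simp add: lit_def)

lemma rAddPar_blocks: "rAddPar as bs z = (\<Union>v\<in>vertices. xor_cnf (block v))"
proof -
  have "rAddPar as bs z = (\<Union>h\<in>{0, 1, 2}. parity_cnf (aux h) (map (lit h) (xs h)))"
    by (simp add: rAddPar_def aux_def xs_def lit_def[abs_def] Un_assoc)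
  also have "{0, 1, 2} = {..2::nat}" by auto
  finally have "rAddPar as bs z = (\<Union>h\<le>2. \<Union>p<num_vertices h. xor_cnf (block (h, p)))"
    by (simp add: parity_cnf_blocks block_def num_vertices_def)
  then show ?thesis unfolding vertices_def by blast
qed

lemma vars_block:
  assumes "(h, p) \<in> vertices"
  shows "var_of ` set (block (h, p)) = aux h ` {j. (j = p \<or> j = p + 1) \<and> 1 \<le> j \<and> j < num_vertices h}
    \<union> XVar ` hosted h {(h, p)}"
proof -
  have "p < parity_vertices (length (map (lit h) (xs h)))"
    using assms by (simp add: vertices_def num_vertices_def)
  moreover have "{var_of (map (lit h) (xs h) ! i) | i. i < length (map (lit h) (xs h))
      \<and> host (length (map (lit h) (xs h))) i = p} = XVar ` hosted h {(h, p)}"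
    by (force simp: hosted_def)
  ultimately show ?thesis
    using vars_parity_block[of p "map (lit h) (xs h)" "aux h"]
    by (simp add: block_def num_vertices_def)
qed

lemma distinct_block: "v \<in> vertices \<Longrightarrow> distinct (map var_of (block v))"
proof -
  assume v: "v \<in> vertices"
  have "map var_of (map (lit (fst v)) (xs (fst v))) = map XVar (xs (fst v))" by simp
  moreover have "inj (aux (fst v))" by (auto simp: inj_def aux_def)
  ultimately show ?thesis
    unfolding block_def using distinct_xs v
    by (intro distinct_parity_block) (auto simp: distinct_map inj_on_def vertices_def num_vertices_def)
qed

lemma hosted_subset: "hosted h S \<subseteq> set (xs h)"
  by (auto simp: hosted_def)

lemma nth_mem_hosted:
  assumes "i < length (xs h)"
  shows "xs h ! i \<in> hosted h S \<longleftrightarrow> (h, host (length (xs h)) i) \<in> S"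
  using assms distinct_xs[of h] by (auto simp: hosted_def nth_eq_iff_index_eq)

text \<open>Consecutive entries lie in the same or in neighbouring constraints, so each change
  between them comes from a cut edge. The extra 1 allows for a change against the initial
  \<open>False\<close>.\<close>

lemma changes_hosted:
  "changes False (map (\<lambda>x. x \<in> hosted h S) (xs h)) \<le> card (cut h S) + 1"
proof -
  let ?m = "length (xs h)" and ?ys = "map (\<lambda>x. x \<in> hosted h S) (xs h)"
  have fin: "finite (cut h S)" by (rule finite_subset[of _ "{..<num_vertices h}"]) (auto simp: cut_def)
  have "{i. i < length ?ys \<and> ?ys ! i \<noteq> (False # ?ys) ! i} \<subseteq> insert 0 (Suc ` cut h S)"
  proof
    fix i assume i: "i \<in> {i. i < length ?ys \<and> ?ys ! i \<noteq> (False # ?ys) ! i}"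
    show "i \<in> insert 0 (Suc ` cut h S)"
    proof (cases i)
      case (Suc j)
      then have *: "((h, host ?m j) \<in> S) \<noteq> ((h, host ?m (Suc j)) \<in> S)"
        using i by (auto simp: nth_mem_hosted)
      then have "host ?m j \<noteq> host ?m (Suc j)" by metis
      \<comment> \<open>The first two literals share a constraint, and so do the last two. Distinct
        hosts therefore occur only in between, where literal \<open>j\<close> lies in constraint
        \<open>j - 1\<close>.\<close>
      then have "host ?m j = j - 1" "host ?m (Suc j) = j" "1 \<le> j"
        by (auto simp: host_def min_def split: if_splits)
      moreover have "host ?m (Suc j) < num_vertices h" unfolding num_vertices_def by (rule host_less)
      ultimately have "j \<in> cut h S" using * by (simp add: cut_def)
      then show ?thesis using Suc by simp
    qed simp
  qed
  then have "changes False ?ys \<le> card (insert 0 (Suc ` cut h S))"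
    unfolding changes_conv_card by (rule card_mono[rotated]) (use fin in simp)
  also have "\<dots> \<le> card (cut h S) + 1"
    using card_insert_le_m1[of "card (cut h S) + 1" "Suc ` cut h S" 0] card_image_le[OF fin, of Suc]
    by simp
  finally show ?thesis .
qed

lemma cut_empty:
  assumes "cut h S = {}" "p < num_vertices h"
  shows "(h, p) \<in> S \<longleftrightarrow> (h, 0) \<in> S"
  using assms(2)
proof (induction p)
  case (Suc p)
  then have "((h, p) \<in> S) = ((h, Suc p) \<in> S)"
    using assms(1) by (auto simp: cut_def dest!: equalityD1 subsetD[of _ _ "Suc p"])
  with Suc show ?case by simp
qed simp

lemma hosted_all_or_none:
  assumes "cut h S = {}"
  shows "hosted h S = (if (h, 0) \<in> S then set (xs h) else {})"
proof -
  have "(h, host (length (xs h)) i) \<in> S \<longleftrightarrow> (h, 0) \<in> S" for i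
    by (rule cut_empty[OF assms]) (simp add: num_vertices_def host_less)
  then show ?thesis by (auto simp: hosted_def set_conv_nth)
qed

text \<open>\<open>aux h j\<close> occurs only in constraints \<open>j - 1\<close> and
  \<open>j\<close> of path \<open>h\<close>, and a cut edge has exactly one of them in
  \<open>S\<close>.\<close>

lemma cut_subset_boundary:
  assumes S: "S \<subseteq> vertices" and h: "h \<le> 2"
  shows "aux h ` cut h S \<subseteq> boundary block S"
proof
  fix y assume "y \<in> aux h ` cut h S"
  then obtain j where j: "y = aux h j" "1 \<le> j" "j < num_vertices h" "((h, j - 1) \<in> S) \<noteq> ((h, j) \<in> S)"
    by (auto simp: cut_def)
  have occ: "v \<in> S \<and> y \<in> var_of ` set (block v) \<longleftrightarrow>
      v \<in> S \<and> fst v = h \<and> (snd v = j \<or> snd v = j - 1)" for v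
  proof (cases "v \<in> S")
    case True
    then have v: "(fst v, snd v) \<in> vertices" using S by auto
    then have "fst v \<le> 2" unfolding vertices_def by blast
    then show ?thesis
      using vars_block[OF v] j(1-3) h True by (auto simp: aux_eq_iff)
  qed simp
  show "y \<in> boundary block S"
    unfolding boundary_def mem_Collect_eq occ using j(4) by (auto simp: prod_eq_iff)
qed

text \<open>The lists have no repetitions, so \<open>x\<close> has at most one constraint on each
  path; if only path \<open>h\<close> hosts it in \<open>S\<close>, the occurrence is
  unique.\<close>

lemma hosted_in_boundary:
  assumes S: "S \<subseteq> vertices" and x: "x \<in> hosted h S"
    and other: "\<And>h'. h' \<le> 2 \<Longrightarrow> h' \<noteq> h \<Longrightarrow> x \<notin> hosted h' S"
  shows "XVar x \<in> boundary block S"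
proof -
  obtain i where i: "i < length (xs h)" "xs h ! i = x" "(h, host (length (xs h)) i) \<in> S"
    using x by (auto simp: hosted_def)
  have "\<exists>!v. v \<in> S \<and> XVar x \<in> var_of ` set (block v)"
  proof (rule ex1I)
    show "(h, host (length (xs h)) i) \<in> S \<and>
        XVar x \<in> var_of ` set (block (h, host (length (xs h)) i))"
      using i S by (auto simp: vars_block subsetD hosted_def)
  next
    fix v assume v: "v \<in> S \<and> XVar x \<in> var_of ` set (block v)"
    obtain h' p where hp: "v = (h', p)" by (cases v)
    with v S have vert: "(h', p) \<in> vertices" by auto
    then have "x \<in> hosted h' {(h', p)}" using v hp vars_block[OF vert] by auto
    then obtain i' where i': "i' < length (xs h')" "xs h' ! i' = x" "host (length (xs h')) i' = p"
      by (auto simp: hosted_def)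
    then have "x \<in> hosted h' S" using v hp by (auto simp: hosted_def)
    then have "h' = h" using other[of h'] vert by (auto simp: vertices_def)
    moreover from this have "i' = i"
      using i i' distinct_xs[of h] by (auto simp: nth_eq_iff_index_eq)
    ultimately show "v = (h, host (length (xs h)) i)" using hp i' by simp
  qed
  then show ?thesis by (simp add: boundary_def)
qed

lemma hosted_single: "card (D \<inter> hosted 0 {v}) \<le> 3" if "v \<in> vertices"
proof (cases v)
  case (Pair h p)
  have fin: "finite (hosted 0 {v})" by (rule finite_subset[OF hosted_subset]) simp
  have "card (D \<inter> hosted 0 {v}) \<le> card (hosted 0 {v})" using fin by (intro card_mono) auto
  also have "\<dots> = card (XVar ` hosted 0 {v})" by (simp add: card_image inj_on_def)
  also have "\<dots> \<le> card (var_of ` set (block v))"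
  proof (rule card_mono)
    show "XVar ` hosted 0 {v} \<subseteq> var_of ` set (block v)"
    proof (cases "h = 0")
      case True
      then show ?thesis using Pair that by (auto simp: vars_block)
    next
      case False
      then have "hosted 0 {v} = {}" using Pair by (auto simp: hosted_def)
      then show ?thesis by simp
    qed
  qed simp
  also have "\<dots> \<le> length (block v)"
    by (rule order_trans[OF card_image_le card_length]) simp
  also have "\<dots> \<le> 3" unfolding block_def by (rule length_parity_block)
  finally show ?thesis .
qed

text \<open>The measure of \<open>S\<close> is the number of elements of \<open>D\<close> hosted on
  the first path. The boundary contains the cut edges of the first two paths and the elements of
  \<open>D\<close> on which their traces disagree, so mixing bounds it from below. The
  \<open>+ 2\<close> absorbs one extra change per path from \<open>changes_hosted\<close>.\<close>

theorem rAddPar_width: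
  assumes D: "D = set as \<inter> set bs" and r: "3 \<le> r" "2 * r < card D"
    and mixed: "well_mixed (w + 2) r D as bs"
  shows "\<not> der (rAddPar as bs z) (clauses_le w) {}"
  unfolding rAddPar_blocks
proof (rule width_lower_bound[where \<mu> = "\<lambda>S. card (D \<inter> hosted 0 S)" and r = r])
  have finD: "finite D" using D by simp
  show "finite vertices" by (simp add: vertices_def)
  show "distinct (map var_of (block v))" if "v \<in> vertices" for v
    using that by (rule distinct_block)
  show "card (D \<inter> hosted 0 S) \<le> card (D \<inter> hosted 0 T)" if "S \<subseteq> T" for S T
    using finD that by (intro card_mono) (auto simp: hosted_def)
  show "card (D \<inter> hosted 0 (S \<union> T)) \<le> card (D \<inter> hosted 0 S) + card (D \<inter> hosted 0 T)" for S T
  proof -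
    have "D \<inter> hosted 0 (S \<union> T) = D \<inter> hosted 0 S \<union> D \<inter> hosted 0 T" by (auto simp: hosted_def)
    then show ?thesis by (simp add: card_Un_le)
  qed
  show "card (D \<inter> hosted 0 {v}) \<le> r" if "v \<in> vertices" for v
    using hosted_single[OF that, of D] r by linarith
  \<comment> \<open>\<open>D\<close> is disjoint from the symmetric difference, so its elements are
    edges between the first two paths only.\<close>
  have h2: "x \<notin> hosted 2 S" if "x \<in> D" for x S
    using that hosted_subset[of 2 S] set_xs(3) D by auto
  have three: "h' = 0 \<or> h' = 1 \<or> h' = 2" if "h' \<le> 2" for h' :: nat
    using that by auto
  have mismatch: "XVar ` {x \<in> D. (x \<in> hosted 0 S) \<noteq> (x \<in> hosted 1 S)} \<subseteq> boundary block S"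
    if S: "S \<subseteq> vertices" for S
  proof (intro image_subsetI)
    fix x assume x: "x \<in> {x \<in> D. (x \<in> hosted 0 S) \<noteq> (x \<in> hosted 1 S)}"
    show "XVar x \<in> boundary block S"
    proof (cases "x \<in> hosted 0 S")
      case True
      then show ?thesis
        by (rule hosted_in_boundary[OF S]) (use x True h2[of x S] in \<open>auto dest!: three\<close>)
    next
      case False
      then have "x \<in> hosted 1 S" using x by blast
      then show ?thesis
        by (rule hosted_in_boundary[OF S]) (use x False h2[of x S] in \<open>auto dest!: three\<close>)
    qed
  qed
  show "w < card (boundary block S)"
    if S: "S \<subseteq> vertices" and range: "r < card (D \<inter> hosted 0 S)" "card (D \<inter> hosted 0 S) \<le> 2 * r"
      and fin: "finite (boundary block S)" for S
  proof (rule ccontr)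
    assume "\<not> ?thesis"
    let ?M = "{x \<in> D. (x \<in> hosted 0 S) \<noteq> (x \<in> hosted 1 S)}"
    have fincut: "finite (cut h S)" for h
      by (rule finite_subset[of _ "{..<num_vertices h}"]) (auto simp: cut_def)
    have "aux 0 ` cut 0 S \<union> aux 1 ` cut 1 S \<union> XVar ` ?M \<subseteq> boundary block S"
      using cut_subset_boundary[OF S] mismatch[OF S] by auto
    then have "card (aux 0 ` cut 0 S \<union> aux 1 ` cut 1 S \<union> XVar ` ?M) \<le> card (boundary block S)"
      by (rule card_mono[OF fin])
    also have "card (aux 0 ` cut 0 S \<union> aux 1 ` cut 1 S \<union> XVar ` ?M)
        = card (aux 0 ` cut 0 S \<union> aux 1 ` cut 1 S) + card (XVar ` ?M)"
      by (rule card_Un_disjoint) (use fincut finD in auto)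
    also have "card (aux 0 ` cut 0 S \<union> aux 1 ` cut 1 S) = card (aux 0 ` cut 0 S) + card (aux 1 ` cut 1 S)"
      by (rule card_Un_disjoint) (use fincut in \<open>auto simp: aux_eq_iff\<close>)
    also have "card (XVar ` ?M) = card ?M" by (rule card_image) (simp add: inj_on_def)
    also have "card (aux 0 ` cut 0 S) = card (cut 0 S)"
      by (rule card_image) (simp add: inj_on_def aux_eq_iff)
    also have "card (aux 1 ` cut 1 S) = card (cut 1 S)"
      by (rule card_image) (simp add: inj_on_def aux_eq_iff)
    finally have "card (cut 0 S) + card (cut 1 S) + card ?M \<le> w"
      using \<open>\<not> w < card (boundary block S)\<close> by linarith
    moreover have "xs 0 = as" "xs 1 = bs" by (simp_all add: xs_def)
    ultimately have "changes False (map (\<lambda>x. x \<in> hosted 0 S) as)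
        + changes False (map (\<lambda>x. x \<in> hosted 1 S) bs) + card ?M \<le> w + 2"
      using changes_hosted[of 0 S] changes_hosted[of 1 S] by simp
    with mixed range show False unfolding well_mixed_def by blast
  qed
  show "boundary block S \<noteq> {}"
    if S: "S \<subseteq> vertices" "S \<noteq> {}" and small: "card (D \<inter> hosted 0 S) \<le> r" for S
  proof
    assume empty: "boundary block S = {}"
    then have cuts: "cut h S = {}" if "h \<le> 2" for h
      using cut_subset_boundary[OF S(1) that] by auto
    \<comment> \<open>Without boundary, \<open>S\<close> contains each path entirely or not at all.
      The whole first path would have measure \<open>card D > r\<close>. Then the elements of
      \<open>D\<close> exclude the second path, and \<open>z\<close>, an edge from the third path to
      one of the others, excludes the third.\<close>
    have all: "hosted h S = (if (h, 0) \<in> S then set (xs h) else {})" if "h \<le> 2" for h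
      by (rule hosted_all_or_none[OF cuts[OF that]])
    have "D \<subseteq> set as" using D by auto
    then have "(0, 0) \<notin> S"
      using all[of 0] small r set_xs(1) by (auto simp: Int_absorb2)
    then have none0: "hosted 0 S = {}" using all[of 0] by simp
    have "D \<noteq> {}" using r by auto
    moreover have "D \<inter> hosted 1 S = {}" using mismatch[OF S(1)] empty none0 by auto
    ultimately have "(1, 0) \<notin> S"
      using all[of 1] set_xs(2) D by auto
    then have none1: "hosted 1 S = {}" using all[of 1] by simp
    have "z \<notin> hosted 2 S"
    proof
      assume "z \<in> hosted 2 S"
      then have "XVar z \<in> boundary block S"
        by (rule hosted_in_boundary[OF S(1)]) (use none0 none1 in \<open>auto dest!: three\<close>)
      then show False using empty by simp
    qed
    then have "(2, 0) \<notin> S" using all[of 2] z set_xs(3) by auto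
    with \<open>(0, 0) \<notin> S\<close> \<open>(1, 0) \<notin> S\<close> have "(h, 0) \<notin> S" if "h \<le> 2" for h
      using three[OF that] by auto
    then have "(h, p) \<notin> S" if "(h, p) \<in> vertices" for h p
      using cut_empty[OF cuts, of h p] that by (auto simp: vertices_def)
    with S show False by (metis equals0I subsetD surj_pair)
  qed
qed

section \<open>Initial width, number of variables and the resulting length bound\<close>

lemma rAddPar_clauses_le: "rAddPar as bs z \<subseteq> clauses_le 3"
proof
  fix C assume "C \<in> rAddPar as bs z"
  then obtain v where "C \<in> xor_cnf (block v)" by (auto simp: rAddPar_blocks)
  then show "C \<in> clauses_le 3"
    using signed_clause_facts(1,2)[of C "block v"]
      length_parity_block[of "aux (fst v)" "map (lit (fst v)) (xs (fst v))" "snd v"]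
    by (simp add: clauses_le_def block_def)
qed

definition all_vars :: "nat \<Rightarrow> var set" where
  "all_vars n = XVar ` {1..n} \<union> SVar ` {1..n} \<union> TVar ` {1..n} \<union> UVar ` {1..n}"

lemma card_all_vars: "finite (all_vars n)" "card (all_vars n) \<le> 4 * n"
proof -
  have c: "card (f ` {1..n}) \<le> n" for f :: "nat \<Rightarrow> var"
    using card_image_le[of "{1..n}" f] by simp
  show "finite (all_vars n)" by (simp add: all_vars_def)
  show "card (all_vars n) \<le> 4 * n"
    unfolding all_vars_def using c[of XVar] c[of SVar] c[of TVar] c[of UVar]
      card_Un_le[of "XVar ` {1..n} \<union> SVar ` {1..n} \<union> TVar ` {1..n}" "UVar ` {1..n}"]
      card_Un_le[of "XVar ` {1..n} \<union> SVar ` {1..n}" "TVar ` {1..n}"]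
      card_Un_le[of "XVar ` {1..n}" "SVar ` {1..n}"]
    by linarith
qed

lemma rAddPar_lits:
  assumes n: "set as \<subseteq> {1..n}" "set bs \<subseteq> {1..n}"
  shows "rAddPar as bs z \<subseteq> Pow (lits (all_vars n))"
proof
  fix C assume "C \<in> rAddPar as bs z"
  then obtain h p where v: "(h, p) \<in> vertices" "C \<in> xor_cnf (block (h, p))"
    by (auto simp: rAddPar_blocks)
  then have "h = 0 \<or> h = 1 \<or> h = 2" by (auto simp: vertices_def)
  then have sub: "set (xs h) \<subseteq> {1..n}" using n set_xs by auto
  then have "length (xs h) \<le> n"
    using card_mono[OF _ sub] distinct_card[OF distinct_xs[of h]] by simp
  \<comment> \<open>The summand 1 covers the empty list, which still has one constraint. Indices of
    auxiliary variables stay at most \<open>n\<close>.\<close>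
  then have "num_vertices h \<le> n + 1" by (auto simp: num_vertices_def parity_vertices_def)
  then have "var_of ` set (block (h, p)) \<subseteq> all_vars n"
    using sub hosted_subset[of h "{(h, p)}"]
    unfolding vars_block[OF v(1)] by (auto simp: all_vars_def aux_def)
  then have "var_of ` C \<subseteq> all_vars n" using signed_clause_facts(3)[OF v(2)] by simp
  then show "C \<in> Pow (lits (all_vars n))" by auto
qed

text \<open>A shorter refutation would allow \<open>size_width\<close> with \<open>b = d\<close> and
  \<open>N = 4 * n\<close> and give width \<open>2 * d + 3\<close>, which
  \<open>rAddPar_width\<close> excludes.\<close>

theorem refutation_length:
  assumes n: "set as \<subseteq> {1..n}" "set bs \<subseteq> {1..n}" and D: "D = set as \<inter> set bs"
    and r: "3 \<le> r" "2 * r < card D" and mixed: "well_mixed (2 * d + 5) r D as bs"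
    and d: "d \<le> n" and ref: "resolution_refutation (rAddPar as bs z) \<pi>"
  shows "exp (real d * real d / (8 * real n)) \<le> real (length \<pi>)"
proof (rule ccontr)
  assume short: "\<not> ?thesis"
  define P where "P = {C \<in> set \<pi>. C \<subseteq> lits (all_vars n)}"
  have "n > 0" using n r D by (cases n) auto
  have "card {C \<in> P. d < card C} \<le> card (set \<pi>)"
    by (rule card_mono) (auto simp: P_def)
  also have "\<dots> \<le> length \<pi>" by (rule card_length)
  finally have fat: "real (card {C \<in> P. d < card C}) < exp (real d * real d / (8 * real n))"
    using short by linarith
  have "0 \<le> 1 - real d / (8 * real n)" using d \<open>n > 0\<close> by (simp add: field_simps)
  \<comment> \<open>By \<open>1 - y \<le> exp (- y)\<close> the power is at most the reciprocal of
    the assumed length bound.\<close>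
  then have "(1 - real d / (8 * real n)) ^ d \<le> exp (- (real d / (8 * real n))) ^ d"
    using exp_ge_add_one_self[of "- (real d / (8 * real n))"] by (intro power_mono) auto
  also have "\<dots> = exp (- (real d * real d / (8 * real n)))"
    by (simp flip: exp_of_nat_mult)
  finally have "real (card {C \<in> P. d < card C}) * (1 - real d / (8 * real n)) ^ d
      \<le> real (card {C \<in> P. d < card C}) * exp (- (real d * real d / (8 * real n)))"
    by (rule mult_left_mono) simp
  also have "\<dots> < exp (real d * real d / (8 * real n)) * exp (- (real d * real d / (8 * real n)))"
    using fat by (rule mult_strict_right_mono) simp
  also have "\<dots> = 1" by (simp flip: exp_add)
  finally have few: "real (card {C \<in> P. d < card C}) * (1 - real d / (2 * real (4 * n))) ^ d < 1"
    by simp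
  have "der (rAddPar as bs z) P {}"
    unfolding P_def by (rule refutation_der[OF ref rAddPar_lits[OF n]])
  then have "der (rAddPar as bs z) (clauses_le (3 + d + d)) {}"
    using card_all_vars[of n] rAddPar_clauses_le few d
    by (intro size_width[where V = "all_vars n" and N = "4 * n"]) (auto simp: P_def)
  moreover have "3 + d + d + 2 = 2 * d + 5" by simp
  ultimately show False using rAddPar_width[OF D r, of "3 + d + d"] mixed by metis
qed

end

section \<open>The random instance\<close>

text \<open>Serves to fix the earlier random choices one by one, so that only the last one has to be
  estimated.\<close>

lemma prob_bind_pmf_le:
  assumes "\<And>x. x \<in> set_pmf p \<Longrightarrow> measure_pmf.prob (f x) E \<le> \<delta>"
  shows "measure_pmf.prob (bind_pmf p f) E \<le> \<delta>"
proof -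
  obtain x where "x \<in> set_pmf p" using set_pmf_not_empty[of p] by blast
  then have \<delta>: "0 \<le> \<delta>" using assms[of x] measure_nonneg[of "f x" E] by linarith
  have "emeasure (bind_pmf p f) E = (\<integral>\<^sup>+x. emeasure (f x) E \<partial>p)" by simp
  also have "\<dots> \<le> (\<integral>\<^sup>+x. ennreal \<delta> \<partial>p)"
    by (rule nn_integral_mono_AE)
      (use assms in \<open>auto simp: AE_measure_pmf_iff measure_pmf.emeasure_eq_measure intro: ennreal_leI\<close>)
  also have "\<dots> = ennreal \<delta>" by simp
  finally show ?thesis using \<delta> by (simp add: measure_pmf.emeasure_eq_measure)
qed

lemma set_pmf_of_Pow: "finite X \<Longrightarrow> set_pmf (pmf_of_set (Pow X)) = Pow X"
  by (rule set_pmf_of_set) auto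

lemma set_pmf_of_permutations:
  "finite A \<Longrightarrow> set_pmf (pmf_of_set (permutations_of_set A)) = permutations_of_set A"
  by (rule set_pmf_of_set) auto

lemma set_random_instance:
  assumes "(A, B, as, bs) \<in> set_pmf (random_instance n)"
  shows "A \<subseteq> {1..n}" "B \<subseteq> {1..n}" "set as = A" "set bs = B" "distinct as" "distinct bs"
proof -
  have AB: "A \<in> Pow {1..n}" "B \<in> Pow {1..n}"
    and perms: "as \<in> set_pmf (pmf_of_set (permutations_of_set A))"
      "bs \<in> set_pmf (pmf_of_set (permutations_of_set B))"
    using assms unfolding random_instance_def by (auto simp: set_pmf_of_Pow)
  show sub: "A \<subseteq> {1..n}" "B \<subseteq> {1..n}" using AB by auto
  have "finite A" "finite B" using sub finite_subset by blast+
  then show "set as = A" "set bs = B" "distinct as" "distinct bs"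
    using perms by (auto simp: set_pmf_of_permutations dest: permutations_of_setD)
qed

text \<open>A Chernoff-type bound: the generating function of \<open>card (A \<inter> B)\<close> at
  \<open>1 / 2\<close> is \<open>(7 / 2) ^ n\<close>, to be compared with the \<open>4 ^ n\<close>
  pairs.\<close>

lemma prob_small_intersection:
  "measure_pmf.prob (random_instance n) {(A, B, as, bs). 8 * card (A \<inter> B) < n} \<le> (7 / 10) ^ (n div 8)"
proof -
  let ?X = "{1..n}" and ?m = "n div 8"
  let ?S = "{(A, B). 8 * card (A \<inter> B) < n} :: (nat set \<times> nat set) set"
  let ?AB = "Pow ?X \<times> Pow ?X"
  have map: "map_pmf (\<lambda>(A, B, as, bs). (A, B)) (random_instance n) = pmf_of_set ?AB"
  proof -
    have "map_pmf (\<lambda>(A, B, as, bs). (A, B)) (random_instance n)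
        = pair_pmf (pmf_of_set (Pow ?X)) (pmf_of_set (Pow ?X))"
      by (simp add: random_instance_def map_bind_pmf pair_pmf_def)
    also have "\<dots> = pmf_of_set ?AB"
    proof (rule pmf_eqI)
      fix \<omega> :: "nat set \<times> nat set"
      have ne: "Pow ?X \<noteq> {}" "?AB \<noteq> {}" by auto
      show "pmf (pair_pmf (pmf_of_set (Pow ?X)) (pmf_of_set (Pow ?X))) \<omega> = pmf (pmf_of_set ?AB) \<omega>"
        using pmf_of_set[OF ne(1)] pmf_of_set[OF ne(2)]
        by (cases \<omega>) (simp add: pmf_pair card_cartesian_product indicator_def)
    qed
    finally show ?thesis .
  qed
  have "measure_pmf.prob (random_instance n) {(A, B, as, bs). 8 * card (A \<inter> B) < n}
      = measure_pmf.prob (pmf_of_set ?AB) ?S"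
    unfolding map[symmetric] measure_map_pmf by (rule arg_cong[of _ _ "measure _"]) auto
  also have "\<dots> = card (?AB \<inter> ?S) / 4 ^ n"
    by (subst measure_pmf_of_set)
      (auto simp: card_cartesian_product card_Pow simp flip: power_mult_distrib)
  also have "\<dots> \<le> (7 / 2) ^ n * 2 ^ ?m / 4 ^ n"
  proof (rule divide_right_mono)
    let ?f = "\<lambda>(A, B). card (A \<inter> B)"
    have "card (?AB \<inter> ?S) \<le> card {s \<in> ?AB. ?f s \<le> ?m}"
      by (rule card_mono) auto
    then have "real (card (?AB \<inter> ?S)) * (1 / 2) ^ ?m \<le> real (card {s \<in> ?AB. ?f s \<le> ?m}) * (1 / 2) ^ ?m"
      by (intro mult_right_mono) auto
    also have "\<dots> \<le> (\<Sum>s\<in>?AB. (1 / 2) ^ ?f s)"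
      by (rule card_le_generating_function) auto
    also have "\<dots> = (\<Sum>A\<in>Pow ?X. \<Sum>B\<in>Pow ?X. (1 / 2) ^ card (A \<inter> B))"
      by (simp add: sum.cartesian_product case_prod_beta)
    also have "\<dots> = (7 / 2) ^ n"
      by (subst sum_power_card_Int) auto
    finally show "real (card (?AB \<inter> ?S)) \<le> (7 / 2) ^ n * 2 ^ ?m"
      by (simp add: power_one_over field_simps)
  qed simp
  also have "\<dots> = (7 / 8) ^ n * 2 ^ ?m"
    by (simp add: power_divide flip: power_mult_distrib)
  also have "\<dots> \<le> (7 / 8) ^ (8 * ?m) * 2 ^ ?m"
    by (intro mult_right_mono power_decreasing) auto
  also have "\<dots> = ((7 / 8) ^ 8 * 2) ^ ?m"
    by (simp add: power_mult power_mult_distrib)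
  \<comment> \<open>\<open>2 * (7 / 8) ^ 8\<close> is about 0.687.\<close>
  also have "\<dots> \<le> (7 / 10) ^ ?m"
    by (rule power_mono) (auto simp: power_divide)
  finally show ?thesis .
qed

text \<open>With \<open>x = 1 / 64\<close> the union bound costs at most
  \<open>3 * (k / 36 + 6 * c)\<close> bits and the binomial coefficient gains at least
  \<open>k / 3 - 1 - c\<close>. As \<open>c\<close> is a small fraction of \<open>n\<close>, the
  gain prevails.\<close>

lemma mixing_parameters:
  fixes n k :: nat
  defines "c \<equiv> 2 * (n div 10000) + 5"
  assumes k: "n \<le> 8 * k"
  shows "((1 + 1 / 64) ^ k / (1 / 64) ^ c) ^ 3 / 2 ^ (k div 3 - c) \<le> 2 powr (96 - real n / 40)"
proof -
  have "(1 + 1 / 64 :: real) ^ k \<le> exp (1 / 64) ^ k"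
    by (intro power_mono exp_ge_add_one_self) simp
  also have "\<dots> = exp (real k * (1 / 64))" by (rule exp_of_nat_mult[symmetric])
  \<comment> \<open>From \<open>ln 2 \<ge> 2 / 3\<close>, the factor \<open>ln 2 / 36\<close> is at
    least \<open>1 / 54\<close>, hence above \<open>1 / 64\<close>.\<close>
  also have "\<dots> \<le> exp (real k / 36 * ln 2)"
    using mult_left_mono[OF ln2_ge_two_thirds, of "real k / 36"] by simp
  also have "\<dots> = 2 powr (real k / 36)" by (simp add: powr_def)
  finally have 1: "(1 + 1 / 64 :: real) ^ k \<le> 2 powr (real k / 36)" .
  have "(64 :: real) ^ c = 2 ^ (6 * c)" by (simp add: power_mult)
  also have "\<dots> = 2 powr (6 * real c)" by (simp flip: powr_realpow)
  finally have "(64 :: real) ^ c = 2 powr (6 * real c)" .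
  then have 2: "1 / (1 / 64 :: real) ^ c = 2 powr (6 * real c)"
    by (simp add: power_one_over)
  have "(1 + 1 / 64) ^ k / (1 / 64) ^ c = (1 + 1 / 64) ^ k * (1 / (1 / 64 :: real) ^ c)" by simp
  also have "\<dots> \<le> 2 powr (real k / 36) * 2 powr (6 * real c)"
    unfolding 2 using 1 by (rule mult_right_mono) simp
  finally have "((1 + 1 / 64) ^ k / (1 / 64 :: real) ^ c) ^ 3
      \<le> (2 powr (real k / 36 + 6 * real c)) ^ 3"
    by (intro power_mono) (auto simp: powr_add)
  also have "\<dots> = 2 powr (3 * (real k / 36 + 6 * real c))"
    by (simp add: powr_power mult.commute)
  finally have 3: "((1 + 1 / 64) ^ k / (1 / 64 :: real) ^ c) ^ 3
    \<le> 2 powr (3 * (real k / 36 + 6 * real c))" .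
  have "k \<le> 3 * (k div 3) + 3" by presburger
  then have "real k \<le> 3 * real (k div 3) + 3" by linarith
  moreover have "real (k div 3) \<le> real (k div 3 - c) + real c" by linarith
  ultimately have "2 powr (real k / 3 - 1 - real c) \<le> 2 powr real (k div 3 - c)"
    by (intro powr_mono) auto
  then have 4: "2 powr (real k / 3 - 1 - real c) \<le> 2 ^ (k div 3 - c)"
    by (simp add: powr_realpow)
  have c: "real c \<le> real n / 5000 + 5" unfolding c_def by linarith
  have k': "real n / 8 \<le> real k" using k by linarith
  have "((1 + 1 / 64) ^ k / (1 / 64 :: real) ^ c) ^ 3 / 2 ^ (k div 3 - c)
      \<le> 2 powr (3 * (real k / 36 + 6 * real c)) / 2 powr (real k / 3 - 1 - real c)"
    by (rule frac_le) (use 3 4 in auto)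
  also have "\<dots> = 2 powr (3 * (real k / 36 + 6 * real c) - (real k / 3 - 1 - real c))"
    by (rule powr_diff[symmetric])
  \<comment> \<open>The exponent is \<open>1 + 19 * c - k / 4\<close>. The bounds on
    \<open>c\<close> and \<open>k\<close> make it at most
    \<open>96 - (1 / 32 - 19 / 5000) * n\<close>, and the bracket exceeds
    \<open>1 / 40\<close>.\<close>
  also have "\<dots> \<le> 2 powr (96 - real n / 40)"
    by (rule powr_mono) (use c k' in \<open>simp_all add: field_simps\<close>)
  finally show ?thesis .
qed

text \<open>With \<open>A\<close>, \<open>B\<close> and \<open>as\<close> fixed, only the order
  \<open>bs\<close> is random, and the counting bound applies with \<open>x = 1 / 64\<close> and a
  third of \<open>card (A \<inter> B)\<close>, rounded down, as \<open>r\<close>.\<close>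

lemma prob_not_well_mixed:
  "measure_pmf.prob (random_instance n) {(A, B, as, bs). n \<le> 8 * card (A \<inter> B)
      \<and> \<not> well_mixed (2 * (n div 10000) + 5) (card (A \<inter> B) div 3) (A \<inter> B) as bs}
    \<le> 2 powr (96 - real n / 40)" (is "measure_pmf.prob _ ?E \<le> ?\<delta>")
  unfolding random_instance_def
proof (rule prob_bind_pmf_le, rule prob_bind_pmf_le, rule prob_bind_pmf_le)
  fix A B as
  assume "A \<in> set_pmf (pmf_of_set (Pow {1..n}))" "B \<in> set_pmf (pmf_of_set (Pow {1..n}))"
    "as \<in> set_pmf (pmf_of_set (permutations_of_set A))"
  then have sub: "A \<subseteq> {1..n}" "B \<subseteq> {1..n}" by (auto simp: set_pmf_of_Pow)
  then have AB: "finite A" "finite B" using finite_subset by blast+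
  with \<open>as \<in> _\<close> have as: "set as = A" "distinct as"
    by (auto simp: set_pmf_of_permutations dest: permutations_of_setD)
  let ?D = "A \<inter> B" and ?c = "2 * (n div 10000) + 5"
  let ?k = "card ?D"
  let ?bad = "{bs \<in> permutations_of_set B. \<not> well_mixed ?c (?k div 3) ?D as bs}"
  show "measure_pmf.prob (bind_pmf (pmf_of_set (permutations_of_set B))
      (\<lambda>bs. return_pmf (A, B, as, bs))) ?E \<le> ?\<delta>"
  proof (cases "n \<le> 8 * ?k")
    case False
    then have "measure_pmf.prob (map_pmf (\<lambda>bs. (A, B, as, bs)) (pmf_of_set (permutations_of_set B))) ?E = 0"
      by (simp add: vimage_def)
    then show ?thesis by (simp add: map_pmf_def)
  next
    case True
    have "measure_pmf.prob (map_pmf (\<lambda>bs. (A, B, as, bs)) (pmf_of_set (permutations_of_set B))) ?E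
        = card (permutations_of_set B \<inter> (\<lambda>bs. (A, B, as, bs)) -` ?E) / fact (card B)"
      unfolding measure_map_pmf by (subst measure_pmf_of_set) (use AB in auto)
    also have "permutations_of_set B \<inter> (\<lambda>bs. (A, B, as, bs)) -` ?E = ?bad"
      using True by auto
    also have "card ?bad / fact (card B)
        \<le> ((1 + 1 / 64) ^ ?k / (1 / 64) ^ ?c) ^ 3 / 2 ^ (?k div 3 - ?c)"
      using card_not_well_mixed[of B ?D as "?k div 3" "1 / 64" ?c] AB as
      by (simp add: field_simps del: power_divide)
    also have "\<dots> \<le> ?\<delta>" by (rule mixing_parameters[OF True])
    finally show ?thesis by (simp add: map_pmf_def)
  qed
qed

theorem theorem2:
  "\<exists>\<alpha>::real. \<alpha> > 0 \<and>
     (\<lambda>n. measure_pmf.prob (random_instance n)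
        {(A, B, as, bs). \<forall>z\<in>sym_diff A B. \<forall>\<pi>.
           resolution_refutation (rAddPar as bs z) \<pi> \<longrightarrow>
           real (length \<pi>) \<ge> 2 powr (\<alpha> * real n)})
     \<longlonglongrightarrow> 1"
proof (intro exI conjI)
  \<comment> \<open>\<open>1 / (8 * 20000 ^ 2)\<close>: with \<open>d = n div 10000\<close>, which
    is at least \<open>n / 20000\<close>, the exponent \<open>d * d / (8 * n)\<close> is at least
    \<open>\<alpha> * n\<close>.\<close>
  define \<alpha> :: real where "\<alpha> = 1 / 3200000000"
  show "0 < \<alpha>" by (simp add: \<alpha>_def)
  let ?hard = "\<lambda>n. {(A, B, as, bs). \<forall>z\<in>sym_diff A B. \<forall>\<pi>.
    resolution_refutation (rAddPar as bs z) \<pi> \<longrightarrow> real (length \<pi>) \<ge> 2 powr (\<alpha> * real n)}"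
  let ?E1 = "\<lambda>n. {(A, B, as, bs). 8 * card (A \<inter> B) < n}"
  let ?E2 = "\<lambda>n. {(A, B, as, bs). n \<le> 8 * card (A \<inter> B)
      \<and> \<not> well_mixed (2 * (n div 10000) + 5) (card (A \<inter> B) div 3) (A \<inter> B) as bs}"
  let ?p = "\<lambda>n. measure_pmf.prob (random_instance n)"
  let ?\<beta> = "\<lambda>n. (7 / 10) ^ (n div 8) + 2 powr (96 - real n / 40) :: real"
  have hard: "\<omega> \<in> ?hard n"
    if n: "20000 \<le> n" and supp: "\<omega> \<in> set_pmf (random_instance n)" and \<omega>: "\<omega> \<notin> ?E1 n \<union> ?E2 n"
    for n \<omega>
  proof -
    obtain A B as bs where eq: "\<omega> = (A, B, as, bs)" by (cases \<omega>)
    note inst = set_random_instance[OF supp[unfolded eq]]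
    let ?D = "A \<inter> B"
    have big: "n \<le> 8 * card ?D"
      and mixed: "well_mixed (2 * (n div 10000) + 5) (card ?D div 3) ?D as bs"
      using \<omega> eq by auto
    have "2 powr (\<alpha> * real n) \<le> real (length \<pi>)"
      if z: "z \<in> sym_diff A B" and \<pi>: "resolution_refutation (rAddPar as bs z) \<pi>" for z \<pi>
    proof -
      interpret parity_instance as bs z
        by unfold_locales (use inst z in auto)
      let ?d = "n div 10000"
      have d: "real n / 20000 \<le> real ?d" using n by linarith
      have "2 powr (\<alpha> * real n) \<le> exp (\<alpha> * real n)"
        using ln_2_less_1 \<open>0 < \<alpha>\<close> by (simp add: powr_def mult_left_le)
      also have "exp (\<alpha> * real n) \<le> exp (real ?d * real ?d / (8 * real n))"
      proof -
        have "\<alpha> * real n = (real n / 20000) * (real n / 20000) / (8 * real n)"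
          using n by (simp add: \<alpha>_def field_simps)
        also have "\<dots> \<le> real ?d * real ?d / (8 * real n)"
          using d by (intro divide_right_mono mult_mono) auto
        finally show ?thesis by simp
      qed
      \<comment> \<open>As \<open>card ?D\<close> is at least \<open>n / 8 \<ge> 2500\<close>, a
        third of it, rounded down, is at least 3, and its double stays below
        \<open>card ?D\<close>.\<close>
      also have "\<dots> \<le> real (length \<pi>)"
        by (rule refutation_length[where D = ?D and r = "card ?D div 3"])
          (use inst big n mixed \<pi> in auto)
      finally show ?thesis .
    qed
    then show ?thesis unfolding eq by blast
  qed
  have lower: "1 - ?\<beta> n \<le> ?p n (?hard n)" if "20000 \<le> n" for n
  proof -
    have "?p n (?E1 n \<union> ?E2 n) \<le> ?p n (?E1 n) + ?p n (?E2 n)"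
      by (rule measure_Un_le) auto
    also have "\<dots> \<le> ?\<beta> n"
      by (rule add_mono[OF prob_small_intersection prob_not_well_mixed])
    finally have "1 - ?\<beta> n \<le> 1 - ?p n (?E1 n \<union> ?E2 n)" by simp
    also have "\<dots> = ?p n (- (?E1 n \<union> ?E2 n))"
      using measure_pmf.prob_compl[of "?E1 n \<union> ?E2 n" "random_instance n"] by (simp add: Compl_eq_Diff_UNIV)
    \<comment> \<open>\<open>hard\<close> speaks only of outcomes in the support, so the inclusion
      of events is used almost surely.\<close>
    also have "\<dots> \<le> ?p n (?hard n)"
      by (rule measure_pmf.finite_measure_mono_AE)
        (use hard[OF that] in \<open>auto simp: AE_measure_pmf_iff simp del: mem_Collect_eq\<close>)
    finally show ?thesis .
  qed
  have "filterlim (\<lambda>n::nat. n div 8) at_top sequentially"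
    unfolding filterlim_at_top
  proof
    fix m :: nat
    show "\<forall>\<^sub>F n in sequentially. m \<le> n div 8"
      by (rule eventually_sequentiallyI[of "8 * m"]) auto
  qed
  then have "(\<lambda>n. (7 / 10 :: real) ^ (n div 8)) \<longlonglongrightarrow> 0"
    by (rule filterlim_compose[OF LIMSEQ_power_zero, rotated]) simp
  moreover have "(\<lambda>n. 2 powr (96 - real n / 40)) \<longlonglongrightarrow> 0" by real_asymp
  ultimately have "(\<lambda>n. 1 - ?\<beta> n) \<longlonglongrightarrow> 1 - (0 + 0)"
    by (intro tendsto_intros)
  then have lim: "(\<lambda>n. 1 - ?\<beta> n) \<longlonglongrightarrow> 1" by simp
  show "(\<lambda>n. ?p n (?hard n)) \<longlonglongrightarrow> 1"
  proof (rule tendsto_sandwich[OF _ _ lim tendsto_const])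
    show "\<forall>\<^sub>F n in sequentially. 1 - ?\<beta> n \<le> ?p n (?hard n)"
      by (rule eventually_sequentiallyI[of 20000]) (rule lower)
  qed simp
qed

end
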